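(* Let $Q$ be a quiver, with $\mathfrak{n}_Q$ the Lie algebra of primitive elements in $H_{Q,\mathrm{nil}}$. Let $Q'$ be a quiver with the same underlying graph as $Q$. (1) If $Q$ and $Q'$ are trees, then $\mathfrak{n}_Q\cong\mathfrak{n}_{Q'}$ as Lie algebras. (2) Suppose that $Q'$ is an equioriented affine Dynkin quiver of type $\tilde{\mathbb{A}}_n$. Then $\mathfrak{n}_Q$ is a central extension of $\mathfrak{n}_{Q'}$.
   Context: Quivers $Q=(Q_0,Q_1,s,t)$ are finite. A quiver is a tree if its underlying undirected graph is a tree; it is of affine Dynkin type $\tilde{\mathbb{A}}$ if its underlying graph is a cycle, and it is then equioriented if it is a directed cycle. An $\mathbb{F}_1$-vector space is a finite pointed set; an $\mathbb{F}_1$-linear map is a pointed function injective on the complement of the preimage of $0$. An $\mathbb{F}_1$-representation $M$ of $Q$ consists of $\mathbb{F}_1$-vector spaces $M_v$ ($v\in Q_0$) and $\mathbb{F}_1$-linear maps $M_\alpha:M_{s(\alpha)}\to M_{t(\alpha)}$ ($\alpha\in Q_1$). A subrepresentation $L\le R$ consists of pointed subsets stable under the maps; $R/L$ is obtained by collapsing each $L_v$ to $0$; direct sums are obtained by gluing pointed sets at $0$. $M$ is nilpotent if there is $N$ such that for all $n\ge N$ the composite of the $M_\alpha$ along every directed path of length $n$ is zero. $H_{Q,\mathrm{nil}}$ is the Hall algebra of the category of nilpotent $\mathbb{F}_1$-representations of $Q$: the $\mathbb{C}$-vector space with basis the isomorphism classes $[M]$ of nilpotent $\mathbb{F}_1$-representations,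 with product $$[M]\cdot[N]=\sum_{[R]}\bigl|\{L\le R\mid L\simeq N,\ R/L\simeq M\}\bigr|\,[R],$$ unit $[0]$, and coproduct $\Delta(f)([M],[N])=f([M\oplus N])$, where elements of $H_{Q,\mathrm{nil}}$ are viewed as finitely supported functions $f$ on isomorphism classes. It is a graded, connected, cocommutative Hopf algebra. $\mathfrak{n}_Q$ is the Lie algebra (under commutator) of its primitive elements. A Lie algebra $\mathfrak{g}$ is a central extension of $\mathfrak{h}$ if there is a surjective Lie algebra homomorphism $\mathfrak{g}\to\mathfrak{h}$ whose kernel is contained in the center of $\mathfrak{g}$ (the kernel may be zero). *)

theory Defs
  imports Complex_Main "Graph_Theory.Graph_Theory"
begin

section \<open>Quivers and their underlying graphs\<close>

text \<open>
  A quiver is a \<^locale>\<open>fin_digraph\<close>: finitely many vertices and arrows, with loops and parallel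
  arrows allowed; \<^const>\<open>tail\<close> is the source map and \<^const>\<open>head\<close> the target map.
\<close>

definition same_underlying_graph ::
  "('v, 'a) pre_digraph \<Rightarrow> ('v, 'a) pre_digraph \<Rightarrow> bool" where
  "same_underlying_graph Q Q' \<longleftrightarrow>
     verts Q = verts Q' \<and> arcs Q = arcs Q' \<and>
     (\<forall>a\<in>arcs Q. {tail Q a, head Q a} = {tail Q' a, head Q' a})"

text \<open>
  The double of a quiver has every arrow in both directions, so its directed walks are the
  undirected walks of \<open>Q\<close>. The library's \<^const>\<open>tree\<close> only excludes directed cycles, and
  \<^const>\<open>mk_symmetric\<close> identifies parallel arrows; neither is suitable for cycles in the
  underlying multigraph.
\<close>

definition double_quiver :: "('v, 'a) pre_digraph \<Rightarrow> ('v, 'a \<times> bool) pre_digraph" where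
  "double_quiver Q =
     \<lparr>verts = verts Q, arcs = arcs Q \<times> UNIV,
      tail = (\<lambda>(a, b). if b then tail Q a else head Q a),
      head = (\<lambda>(a, b). if b then head Q a else tail Q a)\<rparr>"

text \<open>
  Distinctness of the underlying arrows excludes going back along the arrow just used; loops
  and pairs of parallel arrows do count as cycles.
\<close>

definition undirected_cycle :: "('v, 'a) pre_digraph \<Rightarrow> ('a \<times> bool) list \<Rightarrow> bool" where
  "undirected_cycle Q p \<longleftrightarrow>
     pre_digraph.cycle (double_quiver Q) p \<and> distinct (map fst p)"

definition tree_quiver :: "('v, 'a) pre_digraph \<Rightarrow> bool" where
  "tree_quiver Q \<longleftrightarrow> connected Q \<and> (\<nexists>p. undirected_cycle Q p)"

text \<open>The underlying graph is a single cycle on \<open>n + 1\<close> vertices (a loop if \<open>n = 0\<close>).\<close>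

definition affine_type_A :: "nat \<Rightarrow> ('v, 'a) pre_digraph \<Rightarrow> bool" where
  "affine_type_A n Q \<longleftrightarrow>
     card (verts Q) = n + 1 \<and>
     (\<exists>p. undirected_cycle Q p \<and> fst ` set p = arcs Q \<and>
          tail (double_quiver Q) ` set p = verts Q)"

definition directed_cycle_quiver :: "('v, 'a) pre_digraph \<Rightarrow> bool" where
  "directed_cycle_quiver Q \<longleftrightarrow>
     (\<exists>p. pre_digraph.cycle Q p \<and> set p = arcs Q \<and> tail Q ` set p = verts Q)"

definition equioriented_affine_A :: "nat \<Rightarrow> ('v, 'a) pre_digraph \<Rightarrow> bool" where
  "equioriented_affine_A n Q \<longleftrightarrow> affine_type_A n Q \<and> directed_cycle_quiver Q"


section \<open>Representations over the field with one element\<close>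

definition f1_space :: "'x set \<Rightarrow> 'x \<Rightarrow> bool" where
  "f1_space A a \<longleftrightarrow> finite A \<and> a \<in> A"

definition f1_linear :: "'x set \<Rightarrow> 'x \<Rightarrow> 'y set \<Rightarrow> 'y \<Rightarrow> ('x \<Rightarrow> 'y) \<Rightarrow> bool" where
  "f1_linear A a B b f \<longleftrightarrow>
     f ` A \<subseteq> B \<and> f a = b \<and> inj_on f {x \<in> A. f x \<noteq> b}"

record ('v, 'a, 'x) f1_rep =
  rspace :: "'v \<Rightarrow> 'x set"
  rzero :: "'v \<Rightarrow> 'x"
  rmap :: "'a \<Rightarrow> 'x \<Rightarrow> 'x"

definition f1_representation :: "('v, 'a) pre_digraph \<Rightarrow> ('v, 'a, 'x) f1_rep \<Rightarrow> bool" where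
  "f1_representation Q M \<longleftrightarrow>
     (\<forall>v\<in>verts Q. f1_space (rspace M v) (rzero M v)) \<and>
     (\<forall>a\<in>arcs Q. f1_linear (rspace M (tail Q a)) (rzero M (tail Q a))
                          (rspace M (head Q a)) (rzero M (head Q a)) (rmap M a))"

definition rep_iso ::
  "('v, 'a) pre_digraph \<Rightarrow> ('v, 'a, 'x) f1_rep \<Rightarrow> ('v, 'a, 'y) f1_rep \<Rightarrow> bool" where
  "rep_iso Q M N \<longleftrightarrow>
     (\<exists>\<phi>. (\<forall>v\<in>verts Q. f1_linear (rspace M v) (rzero M v) (rspace N v) (rzero N v) (\<phi> v) \<and>
                        bij_betw (\<phi> v) (rspace M v) (rspace N v)) \<and>
          (\<forall>a\<in>arcs Q. \<forall>x\<in>rspace M (tail Q a).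
                        \<phi> (head Q a) (rmap M a x) = rmap N a (\<phi> (tail Q a) x)))"

definition rep_nilpotent :: "('v, 'a) pre_digraph \<Rightarrow> ('v, 'a, 'x) f1_rep \<Rightarrow> bool" where
  "rep_nilpotent Q M \<longleftrightarrow>
     (\<exists>N. \<forall>n\<ge>N. \<forall>u p v. pre_digraph.awalk Q u p v \<and> length p = n \<longrightarrow>
            (\<forall>x\<in>rspace M u. fold (rmap M) p x = rzero M v))"

text \<open>
  Subrepresentations are required to be empty off the vertex set, so that they can be counted.
\<close>

definition subreps ::
  "('v, 'a) pre_digraph \<Rightarrow> ('v, 'a, 'x) f1_rep \<Rightarrow> ('v \<Rightarrow> 'x set) set" where
  "subreps Q R =
     {L. (\<forall>v\<in>verts Q. rzero R v \<in> L v \<and> L v \<subseteq> rspace R v) \<and>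
         (\<forall>v. v \<notin> verts Q \<longrightarrow> L v = {}) \<and>
         (\<forall>a\<in>arcs Q. rmap R a ` L (tail Q a) \<subseteq> L (head Q a))}"

definition rep_restrict ::
  "('v, 'a, 'x) f1_rep \<Rightarrow> ('v \<Rightarrow> 'x set) \<Rightarrow> ('v, 'a, 'x) f1_rep" where
  "rep_restrict R L = R\<lparr>rspace := L\<rparr>"

definition rep_quotient ::
  "('v, 'a) pre_digraph \<Rightarrow> ('v, 'a, 'x) f1_rep \<Rightarrow> ('v \<Rightarrow> 'x set) \<Rightarrow> ('v, 'a, 'x) f1_rep" where
  "rep_quotient Q R L =
     \<lparr>rspace = (\<lambda>v. insert (rzero R v) (rspace R v - L v)),
      rzero = rzero R,
      rmap = (\<lambda>a x. if rmap R a x \<in> L (head Q a) then rzero R (head Q a) else rmap R a x)\<rparr>"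

text \<open>
  The pointed sets \<open>(A, a)\<close> and \<open>(B, b)\<close> glued at their base points are realised as the union
  of the two axes \<open>A \<times> {b}\<close> and \<open>{a} \<times> B\<close>, with base point \<open>(a, b)\<close>.
\<close>

definition rep_sum ::
  "('v, 'a, 'x) f1_rep \<Rightarrow> ('v, 'a, 'y) f1_rep \<Rightarrow> ('v, 'a, 'x \<times> 'y) f1_rep" where
  "rep_sum M N =
     \<lparr>rspace = (\<lambda>v. rspace M v \<times> {rzero N v} \<union> {rzero M v} \<times> rspace N v),
      rzero = (\<lambda>v. (rzero M v, rzero N v)),
      rmap = (\<lambda>a. map_prod (rmap M a) (rmap N a))\<rparr>"

definition zero_rep :: "('v, 'a, nat) f1_rep" where
  "zero_rep = \<lparr>rspace = (\<lambda>_. {0}), rzero = (\<lambda>_. 0), rmap = (\<lambda>_ _. 0)\<rparr>"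


section \<open>The Hall algebra of nilpotent representations\<close>

text \<open>
  Every finite pointed set is in bijection with one consisting of natural numbers, so
  isomorphism classes are taken among the representations on sets of natural numbers; the
  representation \<open>M\<close> defining a class may live on any type.
\<close>

type_synonym ('v, 'a) rep_class = "('v, 'a, nat) f1_rep set"

definition iso_class ::
  "('v, 'a) pre_digraph \<Rightarrow> ('v, 'a, 'x) f1_rep \<Rightarrow> ('v, 'a) rep_class" where
  "iso_class Q M = {N. f1_representation Q N \<and> rep_iso Q M N}"

definition nil_classes :: "('v, 'a) pre_digraph \<Rightarrow> ('v, 'a) rep_class set" where
  "nil_classes Q =
     {iso_class Q M | M :: ('v, 'a, nat) f1_rep. f1_representation Q M \<and> rep_nilpotent Q M}"

definition class_rep :: "('v, 'a) rep_class \<Rightarrow> ('v, 'a, nat) f1_rep" where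
  "class_rep C = (SOME M. M \<in> C)"

definition hall_number ::
  "('v, 'a) pre_digraph \<Rightarrow> ('v, 'a, 'x) f1_rep \<Rightarrow> ('v, 'a, 'y) f1_rep \<Rightarrow>
     ('v, 'a, 'z) f1_rep \<Rightarrow> nat" where
  "hall_number Q M N R =
     card {L \<in> subreps Q R. rep_iso Q (rep_restrict R L) N \<and> rep_iso Q (rep_quotient Q R L) M}"

definition hall_carrier :: "('v, 'a) pre_digraph \<Rightarrow> (('v, 'a) rep_class \<Rightarrow> complex) set" where
  "hall_carrier Q = {f. finite {C. f C \<noteq> 0} \<and> {C. f C \<noteq> 0} \<subseteq> nil_classes Q}"

definition hall_mult ::
  "('v, 'a) pre_digraph \<Rightarrow> (('v, 'a) rep_class \<Rightarrow> complex) \<Rightarrow>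
     (('v, 'a) rep_class \<Rightarrow> complex) \<Rightarrow> ('v, 'a) rep_class \<Rightarrow> complex" where
  "hall_mult Q f g = (\<lambda>C.
     if C \<in> nil_classes Q then
       (\<Sum>A \<in> {A. f A \<noteq> 0}. \<Sum>B \<in> {B. g B \<noteq> 0}.
          f A * g B * of_nat (hall_number Q (class_rep A) (class_rep B) (class_rep C)))
     else 0)"

definition hall_one :: "('v, 'a) pre_digraph \<Rightarrow> ('v, 'a) rep_class \<Rightarrow> complex" where
  "hall_one Q = (\<lambda>C. if C = iso_class Q zero_rep then 1 else 0)"

text \<open>
  Elements of the tensor square are viewed as functions of two isomorphism classes;
  \<open>f \<otimes> g\<close> is the function \<open>\<lambda>A B. f A * g B\<close>.
\<close>

definition hall_comult ::
  "('v, 'a) pre_digraph \<Rightarrow> (('v, 'a) rep_class \<Rightarrow> complex) \<Rightarrow>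
     ('v, 'a) rep_class \<Rightarrow> ('v, 'a) rep_class \<Rightarrow> complex" where
  "hall_comult Q f = (\<lambda>A B. f (iso_class Q (rep_sum (class_rep A) (class_rep B))))"

definition hall_primitives :: "('v, 'a) pre_digraph \<Rightarrow> (('v, 'a) rep_class \<Rightarrow> complex) set" where
  "hall_primitives Q =
     {f \<in> hall_carrier Q. \<forall>A\<in>nil_classes Q. \<forall>B\<in>nil_classes Q.
        hall_comult Q f A B = f A * hall_one Q B + hall_one Q A * f B}"


section \<open>Complex Lie algebras\<close>

record 'g lie_alg =
  lie_carrier :: "'g set"
  lie_zero :: 'g
  lie_add :: "'g \<Rightarrow> 'g \<Rightarrow> 'g"
  lie_scale :: "complex \<Rightarrow> 'g \<Rightarrow> 'g"
  lie_bracket :: "'g \<Rightarrow> 'g \<Rightarrow> 'g"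

definition lie_hom :: "'g lie_alg \<Rightarrow> 'h lie_alg \<Rightarrow> ('g \<Rightarrow> 'h) set" where
  "lie_hom g h =
     {\<phi>. \<phi> ` lie_carrier g \<subseteq> lie_carrier h \<and>
         (\<forall>x\<in>lie_carrier g. \<forall>y\<in>lie_carrier g.
            \<phi> (lie_add g x y) = lie_add h (\<phi> x) (\<phi> y) \<and>
            \<phi> (lie_bracket g x y) = lie_bracket h (\<phi> x) (\<phi> y)) \<and>
         (\<forall>c. \<forall>x\<in>lie_carrier g. \<phi> (lie_scale g c x) = lie_scale h c (\<phi> x))}"

definition lie_isomorphic :: "'g lie_alg \<Rightarrow> 'h lie_alg \<Rightarrow> bool" where
  "lie_isomorphic g h \<longleftrightarrow>
     (\<exists>\<phi>\<in>lie_hom g h. bij_betw \<phi> (lie_carrier g) (lie_carrier h))"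

definition lie_center :: "'g lie_alg \<Rightarrow> 'g set" where
  "lie_center g = {x \<in> lie_carrier g. \<forall>y\<in>lie_carrier g. lie_bracket g x y = lie_zero g}"

definition central_extension :: "'g lie_alg \<Rightarrow> 'h lie_alg \<Rightarrow> bool" where
  "central_extension g h \<longleftrightarrow>
     (\<exists>\<phi>\<in>lie_hom g h. \<phi> ` lie_carrier g = lie_carrier h \<and>
        {x \<in> lie_carrier g. \<phi> x = lie_zero h} \<subseteq> lie_center g)"

definition hall_lie_algebra ::
  "('v, 'a) pre_digraph \<Rightarrow> (('v, 'a) rep_class \<Rightarrow> complex) lie_alg" where
  "hall_lie_algebra Q =
     \<lparr>lie_carrier = hall_primitives Q,
      lie_zero = (\<lambda>_. 0),
      lie_add = (\<lambda>f g C. f C + g C),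
      lie_scale = (\<lambda>c f C. c * f C),
      lie_bracket = (\<lambda>f g C. hall_mult Q f g C - hall_mult Q g f C)\<rparr>"

end

theory Submission
  imports Defs
begin

text \<open>
  A representation over the field with one element is determined by its coefficient quiver: the
  points are the nonzero elements, and the arrows over \<open>a\<close> record which elements the map of \<open>a\<close>
  sends to which. The graphs that occur are the windings of \<open>Q\<close>: distinct arrows over the same
  arrow of \<open>Q\<close> share neither source nor target. Turning around the arrows of a winding over those
  arrows of \<open>Q\<close> on which \<open>Q\<close> and \<open>Q'\<close> disagree gives a winding of \<open>Q'\<close>, so representations of
  \<open>Q\<close> and of \<open>Q'\<close> correspond to each other, although subrepresentations do not.

  A primitive element of the Hall algebra is a finitely supported function on the classes with
  connected coefficient quiver (\<open>hall_primitives_iff\<close>). For such classes, the coefficient of \<open>[K]\<close>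
  in \<open>[G][H] - [H][G]\<close> counts the splittings of the points of \<open>K\<close> into a copy of \<open>H\<close> and a copy
  of \<open>G\<close>, each with sign \<open>1\<close> if all linking arrows point into \<open>H\<close>, sign \<open>-1\<close> if all point into
  \<open>G\<close>, and \<open>0\<close> if there is no linking arrow or there are arrows in both directions
  (\<open>hall_number_diff\<close>). The set of splittings ignores orientations, only the signs depend on them.
  Let the Euler characteristic of a graph be the number of points minus the number of arrows. It is
  at most \<open>1\<close> on connected graphs, with equality for trees, and for a splitting it is the sum of the
  values of the two parts minus the number of linking arrows. If \<open>G\<close>, \<open>H\<close> and \<open>K\<close> are trees,
  every splitting therefore has exactly one linking arrow, and its sign changes precisely when that
  arrow is reversed. Multiplying the class of each tree by \<open>-1\<close> to the number of its reversed
  arrows absorbs this change (\<open>bracket_number_reorient\<close>).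

  It remains to see what happens with connected graphs that are not trees. Over a tree quiver there
  are none: the rank of a map is bounded by the dimensions at both ends, and removing leaves
  one by one shows that every nonzero representation has positive Euler characteristic
  (\<open>euler_char_pos_forest\<close>). Over a cycle the Euler characteristic is nonnegative, and when it
  vanishes all maps are bijective. Such a representation is never nilpotent for the equioriented
  cycle, and for any orientation it cannot be linked to anything else inside a larger
  representation. Hence these classes are central, and mapping them to \<open>0\<close> while transporting the
  trees gives the required surjection.
\<close>

section \<open>Coefficient quivers\<close>

type_synonym ('v, 'a, 'x) arrow_graph = "('v \<times> 'x) set \<times> ('a \<times> 'x \<times> 'x) set"

fun src :: "('v, 'a) pre_digraph \<Rightarrow> 'a \<times> 'x \<times> 'x \<Rightarrow> 'v \<times> 'x" where
  "src Q (a, x, y) = (tail Q a, x)"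

fun tgt :: "('v, 'a) pre_digraph \<Rightarrow> 'a \<times> 'x \<times> 'x \<Rightarrow> 'v \<times> 'x" where
  "tgt Q (a, x, y) = (head Q a, y)"

text \<open>
  A pair \<open>(v, x)\<close> is a point over the vertex \<open>v\<close>, and \<open>(a, x, y)\<close> an arrow over \<open>a\<close> from the point
  \<open>x\<close> over the tail of \<open>a\<close> to the point \<open>y\<close> over its head. The last clause makes each arrow of the
  quiver act as a partial injection, which is what an \<open>f1_linear\<close> map is away from zero.
\<close>

definition winding :: "('v, 'a) pre_digraph \<Rightarrow> ('v, 'a, 'x) arrow_graph \<Rightarrow> bool" where
  "winding Q G \<longleftrightarrow>
     finite (fst G) \<and> fst ` fst G \<subseteq> verts Q \<and>
     (\<forall>e\<in>snd G. fst e \<in> arcs Q \<and> src Q e \<in> fst G \<and> tgt Q e \<in> fst G) \<and>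
     (\<forall>e\<in>snd G. \<forall>e'\<in>snd G. fst e = fst e' \<longrightarrow> src Q e = src Q e' \<or> tgt Q e = tgt Q e' \<longrightarrow> e = e')"

definition coeff_quiver ::
  "('v, 'a) pre_digraph \<Rightarrow> ('v, 'a, 'x) f1_rep \<Rightarrow> ('v, 'a, 'x) arrow_graph" where
  "coeff_quiver Q M =
     ({(v, x). v \<in> verts Q \<and> x \<in> rspace M v \<and> x \<noteq> rzero M v},
      {(a, x, y). a \<in> arcs Q \<and> x \<in> rspace M (tail Q a) \<and> x \<noteq> rzero M (tail Q a) \<and>
                  y \<noteq> rzero M (head Q a) \<and> rmap M a x = y})"

definition rep_of ::
  "('v, 'a) pre_digraph \<Rightarrow> ('v \<Rightarrow> 'x) \<Rightarrow> ('v, 'a, 'x) arrow_graph \<Rightarrow> ('v, 'a, 'x) f1_rep" where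
  "rep_of Q z G =
     \<lparr>rspace = (\<lambda>v. insert (z v) {x. (v, x) \<in> fst G}), rzero = z,
      rmap = (\<lambda>a x. if \<exists>y. (a, x, y) \<in> snd G then THE y. (a, x, y) \<in> snd G else z (head Q a))\<rparr>"

lemma windingD:
  assumes "winding Q G"
  shows "finite (fst G)" "(v, x) \<in> fst G \<Longrightarrow> v \<in> verts Q"
    "(a, x, y) \<in> snd G \<Longrightarrow> a \<in> arcs Q"
    "(a, x, y) \<in> snd G \<Longrightarrow> (tail Q a, x) \<in> fst G"
    "(a, x, y) \<in> snd G \<Longrightarrow> (head Q a, y) \<in> fst G"
    "(a, x, y) \<in> snd G \<Longrightarrow> (a, x, y') \<in> snd G \<Longrightarrow> y = y'"
    "(a, x, y) \<in> snd G \<Longrightarrow> (a, x', y) \<in> snd G \<Longrightarrow> x = x'"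
  using assms by (force simp: winding_def)+

lemma winding_src_tgt:
  assumes "winding Q G" "e \<in> snd G"
  shows "src Q e \<in> fst G" "tgt Q e \<in> fst G" "fst e \<in> arcs Q"
  using assms unfolding winding_def by auto

lemma windingI:
  assumes "finite P" "\<And>v x. (v, x) \<in> P \<Longrightarrow> v \<in> verts Q"
    "\<And>a x y. (a, x, y) \<in> E \<Longrightarrow> a \<in> arcs Q \<and> (tail Q a, x) \<in> P \<and> (head Q a, y) \<in> P"
    "\<And>a x y y'. (a, x, y) \<in> E \<Longrightarrow> (a, x, y') \<in> E \<Longrightarrow> y = y'"
    "\<And>a x x' y. (a, x, y) \<in> E \<Longrightarrow> (a, x', y) \<in> E \<Longrightarrow> x = x'"
  shows "winding Q (P, E)"
  unfolding winding_def using assms by (auto; blast)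

lemma finite_winding_arrows:
  assumes "winding Q G" "finite (arcs Q)"
  shows "finite (snd G)"
proof (rule finite_subset)
  show "snd G \<subseteq> arcs Q \<times> snd ` fst G \<times> snd ` fst G"
  proof
    fix e assume e: "e \<in> snd G"
    obtain a x y where "e = (a, x, y)" by (cases e)
    then show "e \<in> arcs Q \<times> snd ` fst G \<times> snd ` fst G"
      using e windingD(3,4,5)[OF assms(1), of a x y] by (auto intro: rev_image_eqI)
  qed
  show "finite (arcs Q \<times> snd ` fst G \<times> snd ` fst G)"
    using assms windingD(1) by blast
qed

lemma f1_repD:
  assumes "f1_representation Q M"
  shows "v \<in> verts Q \<Longrightarrow> finite (rspace M v)" "v \<in> verts Q \<Longrightarrow> rzero M v \<in> rspace M v"
    "a \<in> arcs Q \<Longrightarrow> x \<in> rspace M (tail Q a) \<Longrightarrow> rmap M a x \<in> rspace M (head Q a)"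
    "a \<in> arcs Q \<Longrightarrow> rmap M a (rzero M (tail Q a)) = rzero M (head Q a)"
    "a \<in> arcs Q \<Longrightarrow> x \<in> rspace M (tail Q a) \<Longrightarrow> y \<in> rspace M (tail Q a) \<Longrightarrow>
       rmap M a x = rmap M a y \<Longrightarrow> rmap M a x \<noteq> rzero M (head Q a) \<Longrightarrow> x = y"
proof -
  show "v \<in> verts Q \<Longrightarrow> finite (rspace M v)" "v \<in> verts Q \<Longrightarrow> rzero M v \<in> rspace M v"
    using assms by (simp_all add: f1_representation_def f1_space_def)
next
  assume "a \<in> arcs Q"
  then have l: "f1_linear (rspace M (tail Q a)) (rzero M (tail Q a))
      (rspace M (head Q a)) (rzero M (head Q a)) (rmap M a)"
    using assms by (simp add: f1_representation_def)
  then show "rmap M a (rzero M (tail Q a)) = rzero M (head Q a)" by (simp add: f1_linear_def)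
  assume x: "x \<in> rspace M (tail Q a)"
  then show "rmap M a x \<in> rspace M (head Q a)" using l by (auto simp: f1_linear_def)
  assume "y \<in> rspace M (tail Q a)" "rmap M a x = rmap M a y" "rmap M a x \<noteq> rzero M (head Q a)"
  then show "x = y" using l x by (auto simp: f1_linear_def dest: inj_onD)
qed

lemma winding_coeff_quiver:
  assumes "fin_digraph Q" "f1_representation Q M"
  shows "winding Q (coeff_quiver Q M)"
proof -
  interpret fin_digraph Q by fact
  note r = f1_repD[OF assms(2)]
  show ?thesis
    unfolding coeff_quiver_def
  proof (rule windingI, goal_cases)
    case 1
    have "{(v, x). v \<in> verts Q \<and> x \<in> rspace M v \<and> x \<noteq> rzero M v} \<subseteq> (SIGMA v:verts Q. rspace M v)"
      by auto
    then show ?case using r(1) by (meson finite_SigmaI finite_subset finite_verts)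
  qed (use r in auto)
qed

text \<open>
  Every winding comes from a representation. This makes it possible to build the
  representations needed later (summands, reorientations) as graphs.
\<close>

lemma rep_of:
  assumes "fin_digraph Q" "winding Q G" "\<And>v. (v, z v) \<notin> fst G"
  shows "f1_representation Q (rep_of Q z G)" "coeff_quiver Q (rep_of Q z G) = G"
proof -
  interpret fin_digraph Q by fact
  note w = windingD[OF assms(2)]
  let ?M = "rep_of Q z G"
  have the: "(THE y. (a, x, y) \<in> snd G) = y" if "(a, x, y) \<in> snd G" for a x y
    using that w(6) by blast
  have m: "rmap ?M a x = y" if "(a, x, y) \<in> snd G" for a x y
    using that the[OF that] by (auto simp: rep_of_def)
  have m0: "rmap ?M a x = z (head Q a)" if "\<nexists>y. (a, x, y) \<in> snd G" for a x
    using that by (auto simp: rep_of_def)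
  have s: "rspace ?M v = insert (z v) {x. (v, x) \<in> fst G}" "rzero ?M = z" for v
    by (auto simp: rep_of_def)
  have nz: "(a, z (tail Q a), y) \<notin> snd G" "(a, x, z (head Q a)) \<notin> snd G" for a x y
    using w(4,5) assms(3) by blast+
  have mm: "rmap ?M a x = z (head Q a) \<or> (a, x, rmap ?M a x) \<in> snd G" for a x
    using m m0 by metis
  show "f1_representation Q ?M"
    unfolding f1_representation_def
  proof (intro conjI ballI)
    fix v
    have "{x. (v, x) \<in> fst G} \<subseteq> snd ` fst G" by force
    then show "f1_space (rspace ?M v) (rzero ?M v)"
      unfolding f1_space_def s using w(1) by (auto intro: finite_subset)
  next
    fix a assume a: "a \<in> arcs Q"
    show "f1_linear (rspace ?M (tail Q a)) (rzero ?M (tail Q a))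
            (rspace ?M (head Q a)) (rzero ?M (head Q a)) (rmap ?M a)"
      unfolding f1_linear_def s inj_on_def
    proof (intro conjI ballI impI)
      show "rmap ?M a ` insert (z (tail Q a)) {x. (tail Q a, x) \<in> fst G}
              \<subseteq> insert (z (head Q a)) {x. (head Q a, x) \<in> fst G}"
        using mm w(5) by blast
      show "rmap ?M a (z (tail Q a)) = z (head Q a)" using m0 nz by blast
    next
      fix x y
      assume "x \<in> {x \<in> insert (z (tail Q a)) {x. (tail Q a, x) \<in> fst G}. rmap ?M a x \<noteq> z (head Q a)}"
        "y \<in> {x \<in> insert (z (tail Q a)) {x. (tail Q a, x) \<in> fst G}. rmap ?M a x \<noteq> z (head Q a)}"
        "rmap ?M a x = rmap ?M a y"
      then have "(a, x, rmap ?M a x) \<in> snd G" "(a, y, rmap ?M a x) \<in> snd G"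
        using mm[of a x] mm[of a y] by auto
      then show "x = y" by (rule w(7))
    qed
  qed
  have "snd (coeff_quiver Q ?M) = snd G"
    unfolding coeff_quiver_def s using m mm nz w(3,4) by (auto; metis)
  moreover have "fst (coeff_quiver Q ?M) = fst G"
    unfolding coeff_quiver_def s using w(2) assms(3) by auto
  ultimately show "coeff_quiver Q ?M = G" by (simp add: prod_eq_iff)
qed

definition pmap :: "('v \<Rightarrow> 'x \<Rightarrow> 'y) \<Rightarrow> 'v \<times> 'x \<Rightarrow> 'v \<times> 'y" where
  "pmap \<phi> = (\<lambda>(v, x). (v, \<phi> v x))"

definition amap ::
  "('v, 'a) pre_digraph \<Rightarrow> ('v \<Rightarrow> 'x \<Rightarrow> 'y) \<Rightarrow> 'a \<times> 'x \<times> 'x \<Rightarrow> 'a \<times> 'y \<times> 'y" where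
  "amap Q \<phi> = (\<lambda>(a, x, y). (a, \<phi> (tail Q a) x, \<phi> (head Q a) y))"

definition iso_by ::
  "('v, 'a) pre_digraph \<Rightarrow> ('v \<Rightarrow> 'x \<Rightarrow> 'y) \<Rightarrow>
     ('v, 'a, 'x) arrow_graph \<Rightarrow> ('v, 'a, 'y) arrow_graph \<Rightarrow> bool" where
  "iso_by Q \<phi> G H \<longleftrightarrow> bij_betw (pmap \<phi>) (fst G) (fst H) \<and> snd H = amap Q \<phi> ` snd G"

definition graph_iso ::
  "('v, 'a) pre_digraph \<Rightarrow> ('v, 'a, 'x) arrow_graph \<Rightarrow> ('v, 'a, 'y) arrow_graph \<Rightarrow> bool" where
  "graph_iso Q G H \<longleftrightarrow> (\<exists>\<phi>. iso_by Q \<phi> G H)"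

lemma fst_amap [simp]: "fst (amap Q \<phi> e) = fst e"
  by (cases e) (simp add: amap_def)

lemma src_amap [simp]: "src Q (amap Q \<phi> e) = pmap \<phi> (src Q e)"
  by (cases e) (simp add: amap_def pmap_def)

lemma tgt_amap [simp]: "tgt Q (amap Q \<phi> e) = pmap \<phi> (tgt Q e)"
  by (cases e) (simp add: amap_def pmap_def)

lemma arrow_eqI: "fst e = fst e' \<Longrightarrow> src Q e = src Q e' \<Longrightarrow> tgt Q e = tgt Q e' \<Longrightarrow> e = e'"
  by (cases e; cases e') auto

lemma inj_on_amap:
  assumes "winding Q G" "inj_on (pmap \<phi>) (fst G)"
  shows "inj_on (amap Q \<phi>) (snd G)"
proof (rule inj_onI)
  fix e e' assume e: "e \<in> snd G" "e' \<in> snd G" and eq: "amap Q \<phi> e = amap Q \<phi> e'"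
  have "fst e = fst e'" using eq by (metis fst_amap)
  moreover have "src Q e = src Q e'"
    using eq e by (metis src_amap assms inj_onD winding_src_tgt(1))
  moreover have "tgt Q e = tgt Q e'"
    using eq e by (metis tgt_amap assms inj_onD winding_src_tgt(2))
  ultimately show "e = e'" by (rule arrow_eqI)
qed

lemma graph_iso_refl: "graph_iso Q G G"
  unfolding graph_iso_def iso_by_def
  by (rule exI[of _ "\<lambda>v x. x"]) (auto simp: pmap_def amap_def bij_betw_def)

lemma graph_iso_trans:
  assumes "graph_iso Q G H" "graph_iso Q H K"
  shows "graph_iso Q G K"
proof -
  obtain \<phi> \<psi> where i: "iso_by Q \<phi> G H" "iso_by Q \<psi> H K"
    using assms unfolding graph_iso_def by blast
  have p: "pmap (\<lambda>v. \<psi> v \<circ> \<phi> v) = pmap \<psi> \<circ> pmap \<phi>"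
    and a: "amap Q (\<lambda>v. \<psi> v \<circ> \<phi> v) = amap Q \<psi> \<circ> amap Q \<phi>"
    by (auto simp: pmap_def amap_def fun_eq_iff)
  have "iso_by Q (\<lambda>v. \<psi> v \<circ> \<phi> v) G K"
    unfolding iso_by_def p a using i unfolding iso_by_def
    by (metis bij_betw_trans image_comp)
  then show ?thesis unfolding graph_iso_def by blast
qed

text \<open>
  The winding condition guarantees that arrows end in points of the graph, so that an inverse on
  the points is also an inverse on the arrows.
\<close>

lemma graph_iso_sym:
  assumes "winding Q G" "graph_iso Q G H"
  shows "graph_iso Q H G"
proof -
  obtain \<phi> where i: "bij_betw (pmap \<phi>) (fst G) (fst H)" "snd H = amap Q \<phi> ` snd G"
    using assms unfolding graph_iso_def iso_by_def by blast
  define \<psi> where "\<psi> v y = (SOME x. (v, x) \<in> fst G \<and> \<phi> v x = y)" for v y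
  have \<psi>: "\<psi> v (\<phi> v x) = x" if "(v, x) \<in> fst G" for v x
    unfolding \<psi>_def
  proof (rule some_equality)
    fix x' assume "(v, x') \<in> fst G \<and> \<phi> v x' = \<phi> v x"
    then show "x' = x"
      using that i(1) inj_onD[of "pmap \<phi>" "fst G" "(v,x')" "(v,x)"]
      by (auto simp: bij_betw_def pmap_def)
  qed (use that in auto)
  have p: "pmap \<psi> (pmap \<phi> q) = q" if "q \<in> fst G" for q
    using that \<psi> by (cases q) (auto simp: pmap_def)
  have a: "amap Q \<psi> (amap Q \<phi> e) = e" if "e \<in> snd G" for e
    using that \<psi> windingD(4,5)[OF assms(1)] by (cases e) (auto simp: amap_def)
  have "iso_by Q \<psi> H G"
    unfolding iso_by_def
  proof
    have "fst H = pmap \<phi> ` fst G" using i by (simp add: bij_betw_def)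
    then show "bij_betw (pmap \<psi>) (fst H) (fst G)"
      by (auto simp: bij_betw_def inj_on_def image_image p)
    show "snd G = amap Q \<psi> ` snd H" unfolding i(2) image_image using a by auto
  qed
  then show ?thesis unfolding graph_iso_def by blast
qed

text \<open>
  A bijection of pointed sets is the same as a bijection of the nonzero elements, and it commutes
  with the maps if it matches the arrows: since every arrow of the second graph comes from one of
  the first, elements sent to zero correspond to elements sent to zero.
\<close>

lemma rep_iso_iff_graph_iso:
  assumes "fin_digraph Q" "f1_representation Q M" "f1_representation Q N"
  shows "rep_iso Q M N \<longleftrightarrow> graph_iso Q (coeff_quiver Q M) (coeff_quiver Q N)"
proof -
  interpret fin_digraph Q by fact
  note m = f1_repD[OF assms(2)] and n = f1_repD[OF assms(3)]
  show ?thesis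
  proof
    assume "rep_iso Q M N"
    then obtain \<phi> where h: "\<forall>v\<in>verts Q. f1_linear (rspace M v) (rzero M v) (rspace N v) (rzero N v) (\<phi> v) \<and>
        bij_betw (\<phi> v) (rspace M v) (rspace N v)"
      and c: "\<And>a x. a \<in> arcs Q \<Longrightarrow> x \<in> rspace M (tail Q a) \<Longrightarrow>
           \<phi> (head Q a) (rmap M a x) = rmap N a (\<phi> (tail Q a) x)"
      unfolding rep_iso_def by blast
    then have \<phi>: "\<And>v. v \<in> verts Q \<Longrightarrow> bij_betw (\<phi> v) (rspace M v) (rspace N v)"
      "\<And>v. v \<in> verts Q \<Longrightarrow> \<phi> v (rzero M v) = rzero N v"
      by (simp_all add: f1_linear_def)
    have inj: "\<And>v x y. v \<in> verts Q \<Longrightarrow> x \<in> rspace M v \<Longrightarrow> y \<in> rspace M v \<Longrightarrow> \<phi> v x = \<phi> v y \<Longrightarrow> x = y"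
      and on: "\<And>v. v \<in> verts Q \<Longrightarrow> \<phi> v ` rspace M v = rspace N v"
      using \<phi>(1) by (auto simp: bij_betw_def inj_on_def)
    have z: "\<phi> v x = rzero N v \<longleftrightarrow> x = rzero M v" if "v \<in> verts Q" "x \<in> rspace M v" for v x
      using that \<phi>(2) inj m(2) by metis
    have "iso_by Q \<phi> (coeff_quiver Q M) (coeff_quiver Q N)"
      unfolding iso_by_def
    proof
      show "bij_betw (pmap \<phi>) (fst (coeff_quiver Q M)) (fst (coeff_quiver Q N))"
        unfolding bij_betw_def
      proof
        show "inj_on (pmap \<phi>) (fst (coeff_quiver Q M))"
          by (auto simp: inj_on_def pmap_def coeff_quiver_def intro: inj)
        show "pmap \<phi> ` fst (coeff_quiver Q M) = fst (coeff_quiver Q N)"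
        proof
          show "pmap \<phi> ` fst (coeff_quiver Q M) \<subseteq> fst (coeff_quiver Q N)"
            using on z by (auto simp: pmap_def coeff_quiver_def)
          show "fst (coeff_quiver Q N) \<subseteq> pmap \<phi> ` fst (coeff_quiver Q M)"
          proof
            fix q assume "q \<in> fst (coeff_quiver Q N)"
            then obtain v y where q: "q = (v, y)" "v \<in> verts Q" "y \<in> rspace N v" "y \<noteq> rzero N v"
              by (auto simp: coeff_quiver_def)
            then obtain x where x: "x \<in> rspace M v" "y = \<phi> v x" using on by blast
            then have "(v, x) \<in> fst (coeff_quiver Q M)" "pmap \<phi> (v, x) = q"
              using q z by (auto simp: pmap_def coeff_quiver_def)
            then show "q \<in> pmap \<phi> ` fst (coeff_quiver Q M)" by blast
          qed
        qed
      qed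
      show "snd (coeff_quiver Q N) = amap Q \<phi> ` snd (coeff_quiver Q M)"
      proof
        show "amap Q \<phi> ` snd (coeff_quiver Q M) \<subseteq> snd (coeff_quiver Q N)"
        proof
          fix e' assume "e' \<in> amap Q \<phi> ` snd (coeff_quiver Q M)"
          then obtain a x where h: "e' = (a, \<phi> (tail Q a) x, \<phi> (head Q a) (rmap M a x))" "a \<in> arcs Q"
            "x \<in> rspace M (tail Q a)" "x \<noteq> rzero M (tail Q a)" "rmap M a x \<noteq> rzero M (head Q a)"
            by (auto simp: amap_def coeff_quiver_def)
          moreover have "\<phi> (tail Q a) x \<in> rspace N (tail Q a)"
            using h on[of "tail Q a"] by auto
          moreover have "\<phi> (tail Q a) x \<noteq> rzero N (tail Q a)"
            using h z[of "tail Q a" x] by auto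
          moreover have "\<phi> (head Q a) (rmap M a x) \<noteq> rzero N (head Q a)"
            using h z[of "head Q a" "rmap M a x"] m(3) by auto
          ultimately show "e' \<in> snd (coeff_quiver Q N)"
            using c by (auto simp: coeff_quiver_def)
        qed
        show "snd (coeff_quiver Q N) \<subseteq> amap Q \<phi> ` snd (coeff_quiver Q M)"
        proof
          fix e' assume "e' \<in> snd (coeff_quiver Q N)"
          then obtain a y where h: "e' = (a, y, rmap N a y)" "a \<in> arcs Q"
            "y \<in> rspace N (tail Q a)" "y \<noteq> rzero N (tail Q a)" "rmap N a y \<noteq> rzero N (head Q a)"
            by (auto simp: coeff_quiver_def)
          obtain x where x: "x \<in> rspace M (tail Q a)" "y = \<phi> (tail Q a) x"
            using h on[of "tail Q a"] by auto
          have "rmap M a x \<noteq> rzero M (head Q a)"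
            using h c[OF h(2) x(1)] x \<phi>(2) by auto
          then have "(a, x, rmap M a x) \<in> snd (coeff_quiver Q M)"
            using h x \<phi>(2) by (auto simp: coeff_quiver_def)
          moreover have "e' = amap Q \<phi> (a, x, rmap M a x)"
            using h x c by (auto simp: amap_def)
          ultimately show "e' \<in> amap Q \<phi> ` snd (coeff_quiver Q M)" by blast
        qed
      qed
    qed
    then show "graph_iso Q (coeff_quiver Q M) (coeff_quiver Q N)" unfolding graph_iso_def by blast
  next
    assume "graph_iso Q (coeff_quiver Q M) (coeff_quiver Q N)"
    then obtain \<phi> where b: "bij_betw (pmap \<phi>) (fst (coeff_quiver Q M)) (fst (coeff_quiver Q N))"
      and e: "snd (coeff_quiver Q N) = amap Q \<phi> ` snd (coeff_quiver Q M)"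
      unfolding graph_iso_def iso_by_def by blast
    have P: "(v, x) \<in> fst (coeff_quiver Q M) \<longleftrightarrow> v \<in> verts Q \<and> x \<in> rspace M v \<and> x \<noteq> rzero M v"
      "(v, y) \<in> fst (coeff_quiver Q N) \<longleftrightarrow> v \<in> verts Q \<and> y \<in> rspace N v \<and> y \<noteq> rzero N v" for v x y
      by (auto simp: coeff_quiver_def)
    define \<psi> where "\<psi> v x = (if x = rzero M v then rzero N v else \<phi> v x)" for v x
    have into: "\<phi> v x \<in> rspace N v \<and> \<phi> v x \<noteq> rzero N v"
      if "v \<in> verts Q" "x \<in> rspace M v" "x \<noteq> rzero M v" for v x
      using that P bij_betwE[OF b] by (fastforce simp: pmap_def)
    have b\<psi>: "bij_betw (\<psi> v) (rspace M v) (rspace N v)" if v: "v \<in> verts Q" for v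
      unfolding bij_betw_def
    proof
      show "inj_on (\<psi> v) (rspace M v)"
      proof (rule inj_onI)
        fix x y assume xy: "x \<in> rspace M v" "y \<in> rspace M v" "\<psi> v x = \<psi> v y"
        show "x = y"
        proof (cases "x = rzero M v \<or> y = rzero M v")
          case True
          then show ?thesis using into[OF v] xy unfolding \<psi>_def by (metis)
        next
          case False
          then have "pmap \<phi> (v, x) = pmap \<phi> (v, y)" using xy by (auto simp: pmap_def \<psi>_def)
          then show ?thesis using b xy False P(1)[of v] v by (auto simp: bij_betw_def dest: inj_onD)
        qed
      qed
      show "\<psi> v ` rspace M v = rspace N v"
      proof
        show "\<psi> v ` rspace M v \<subseteq> rspace N v" using into[OF v] n(2)[OF v] by (auto simp: \<psi>_def)
        show "rspace N v \<subseteq> \<psi> v ` rspace M v"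
        proof
          fix y assume y: "y \<in> rspace N v"
          show "y \<in> \<psi> v ` rspace M v"
          proof (cases "y = rzero N v")
            case True
            then show ?thesis using m(2)[OF v] by (auto simp: \<psi>_def)
          next
            case False
            then have "(v, y) \<in> pmap \<phi> ` fst (coeff_quiver Q M)" using b P(2) v y by (auto simp: bij_betw_def)
            then obtain x where "(v, x) \<in> fst (coeff_quiver Q M)" "y = \<phi> v x" by (auto simp: pmap_def)
            then show ?thesis using P(1)[of v x] by (auto simp: \<psi>_def)
          qed
        qed
      qed
    qed
    have com: "\<psi> (head Q a) (rmap M a x) = rmap N a (\<psi> (tail Q a) x)"
      if a: "a \<in> arcs Q" and x: "x \<in> rspace M (tail Q a)" for a x
    proof (cases "x = rzero M (tail Q a)")
      case True
      then show ?thesis using m(4)[OF a] n(4)[OF a] by (simp add: \<psi>_def)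
    next
      case x0: False
      show ?thesis
      proof (cases "rmap M a x = rzero M (head Q a)")
        case False
        then have "(a, x, rmap M a x) \<in> snd (coeff_quiver Q M)" using a x x0 by (auto simp: coeff_quiver_def)
        then have "(a, \<phi> (tail Q a) x, \<phi> (head Q a) (rmap M a x)) \<in> snd (coeff_quiver Q N)"
          unfolding e by (force simp: amap_def)
        then show ?thesis using x0 False by (auto simp: coeff_quiver_def \<psi>_def)
      next
        case True
        have "rmap N a (\<phi> (tail Q a) x) = rzero N (head Q a)"
        proof (rule ccontr)
          assume "\<not> ?thesis"
          then have "(a, \<phi> (tail Q a) x, rmap N a (\<phi> (tail Q a) x)) \<in> snd (coeff_quiver Q N)"
            using into[OF _ x x0] a by (auto simp: coeff_quiver_def)
          then obtain x' y' where h: "(a, x', y') \<in> snd (coeff_quiver Q M)" "\<phi> (tail Q a) x = \<phi> (tail Q a) x'"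
            unfolding e by (auto simp: amap_def)
          then have "(tail Q a, x') \<in> fst (coeff_quiver Q M)" "(tail Q a, x) \<in> fst (coeff_quiver Q M)"
            using x x0 a by (auto simp: coeff_quiver_def)
          then have "x = x'" using h(2) b
            inj_onD[of "pmap \<phi>" "fst (coeff_quiver Q M)" "(tail Q a, x)" "(tail Q a, x')"]
            by (auto simp: bij_betw_def pmap_def)
          then show False using h(1) True by (auto simp: coeff_quiver_def)
        qed
        then show ?thesis using x0 True by (simp add: \<psi>_def)
      qed
    qed
    have lin: "f1_linear (rspace M v) (rzero M v) (rspace N v) (rzero N v) (\<psi> v)"
      if "v \<in> verts Q" for v
      using b\<psi>[OF that] unfolding f1_linear_def bij_betw_def inj_on_def by (auto simp: \<psi>_def)
    show "rep_iso Q M N" unfolding rep_iso_def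
      using b\<psi> com lin by (intro exI[of _ \<psi>]) auto
  qed
qed

section \<open>Subrepresentations, quotients and Hall numbers\<close>

definition sub_quiver ::
  "('v, 'a) pre_digraph \<Rightarrow> ('v, 'a, 'x) arrow_graph \<Rightarrow> ('v \<times> 'x) set \<Rightarrow> ('v, 'a, 'x) arrow_graph" where
  "sub_quiver Q G S = (S, {e \<in> snd G. src Q e \<in> S \<and> tgt Q e \<in> S})"

definition outgoing ::
  "('v, 'a) pre_digraph \<Rightarrow> ('v, 'a, 'x) arrow_graph \<Rightarrow> ('v \<times> 'x) set \<Rightarrow> ('a \<times> 'x \<times> 'x) set" where
  "outgoing Q G S = {e \<in> snd G. src Q e \<in> S \<and> tgt Q e \<notin> S}"

definition incoming ::
  "('v, 'a) pre_digraph \<Rightarrow> ('v, 'a, 'x) arrow_graph \<Rightarrow> ('v \<times> 'x) set \<Rightarrow> ('a \<times> 'x \<times> 'x) set" where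
  "incoming Q G S = {e \<in> snd G. src Q e \<notin> S \<and> tgt Q e \<in> S}"

abbreviation links ::
  "('v, 'a) pre_digraph \<Rightarrow> ('v, 'a, 'x) arrow_graph \<Rightarrow> ('v \<times> 'x) set \<Rightarrow> ('a \<times> 'x \<times> 'x) set" where
  "links Q G S \<equiv> outgoing Q G S \<union> incoming Q G S"

text \<open>
  The points of \<open>H\<close> are those of the candidate subrepresentation, the points of \<open>G\<close> those of
  the candidate quotient. The arrows linking the two parts do not enter, and because of this the set
  is the same for all orientations of the quiver.
\<close>

definition splits ::
  "('v, 'a) pre_digraph \<Rightarrow> ('v, 'a, 'x) arrow_graph \<Rightarrow> ('v, 'a, 'y) arrow_graph \<Rightarrow>
     ('v, 'a, 'z) arrow_graph \<Rightarrow> ('v \<times> 'z) set set" where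
  "splits Q G H K = {S. S \<subseteq> fst K \<and> graph_iso Q (sub_quiver Q K S) H \<and>
                       graph_iso Q (sub_quiver Q K (fst K - S)) G}"

lemma fst_sub_quiver [simp]: "fst (sub_quiver Q G S) = S"
  by (simp add: sub_quiver_def)

lemma sub_quiver_all:
  assumes "winding Q G"
  shows "sub_quiver Q G (fst G) = G"
  using winding_src_tgt[OF assms] by (auto simp: sub_quiver_def prod_eq_iff)

lemma winding_sub_quiver:
  assumes "winding Q G" "S \<subseteq> fst G"
  shows "winding Q (sub_quiver Q G S)"
  unfolding sub_quiver_def
proof (rule windingI)
  show "finite S" using assms windingD(1) finite_subset by blast
qed (use assms windingD(2-7)[OF assms(1)] in auto)

lemma coeff_quiver_restrict:
  assumes "fin_digraph Q" "f1_representation Q R" "L \<in> subreps Q R"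
  defines "S \<equiv> {(v, x). v \<in> verts Q \<and> x \<in> L v \<and> x \<noteq> rzero R v}"
  shows "f1_representation Q (rep_restrict R L)"
    and "coeff_quiver Q (rep_restrict R L) = sub_quiver Q (coeff_quiver Q R) S"
proof -
  interpret fin_digraph Q by fact
  note r = f1_repD[OF assms(2)]
  have L: "\<And>v. v \<in> verts Q \<Longrightarrow> rzero R v \<in> L v" "\<And>v. v \<in> verts Q \<Longrightarrow> L v \<subseteq> rspace R v"
    "\<And>a x. a \<in> arcs Q \<Longrightarrow> x \<in> L (tail Q a) \<Longrightarrow> rmap R a x \<in> L (head Q a)"
    using assms(3) by (auto simp: subreps_def image_subset_iff)
  show "f1_representation Q (rep_restrict R L)"
    unfolding f1_representation_def
  proof (intro conjI ballI)
    fix v assume "v \<in> verts Q"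
    then show "f1_space (rspace (rep_restrict R L) v) (rzero (rep_restrict R L) v)"
      using L(1,2) finite_subset[OF L(2) r(1)] by (auto simp: f1_space_def rep_restrict_def)
  next
    fix a assume a: "a \<in> arcs Q"
    have "\<And>x. x \<in> L (tail Q a) \<Longrightarrow> x \<in> rspace R (tail Q a)"
      using L(2)[of "tail Q a"] a by auto
    then show "f1_linear (rspace (rep_restrict R L) (tail Q a)) (rzero (rep_restrict R L) (tail Q a))
      (rspace (rep_restrict R L) (head Q a)) (rzero (rep_restrict R L) (head Q a)) (rmap (rep_restrict R L) a)"
      using L(3)[OF a] r(4,5)[OF a] unfolding f1_linear_def inj_on_def
      by (auto simp: rep_restrict_def)
  qed
  have "L (tail Q a) \<subseteq> rspace R (tail Q a)" if "a \<in> arcs Q" for a using L that by auto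
  then show "coeff_quiver Q (rep_restrict R L) = sub_quiver Q (coeff_quiver Q R) S"
    unfolding coeff_quiver_def sub_quiver_def rep_restrict_def S_def using L(3)
    by auto
qed

lemma coeff_quiver_quotient:
  assumes "fin_digraph Q" "f1_representation Q R" "L \<in> subreps Q R"
  defines "S \<equiv> {(v, x). v \<in> verts Q \<and> x \<in> L v \<and> x \<noteq> rzero R v}"
  shows "f1_representation Q (rep_quotient Q R L)"
    and "coeff_quiver Q (rep_quotient Q R L) =
           sub_quiver Q (coeff_quiver Q R) (fst (coeff_quiver Q R) - S)"
proof -
  interpret fin_digraph Q by fact
  note r = f1_repD[OF assms(2)]
  have L: "\<And>v. v \<in> verts Q \<Longrightarrow> rzero R v \<in> L v"
    using assms(3) by (auto simp: subreps_def)
  show "f1_representation Q (rep_quotient Q R L)"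
    unfolding f1_representation_def
  proof (intro conjI ballI)
    fix v assume "v \<in> verts Q"
    then show "f1_space (rspace (rep_quotient Q R L) v) (rzero (rep_quotient Q R L) v)"
      using r(1) by (auto simp: f1_space_def rep_quotient_def)
  next
    fix a assume a: "a \<in> arcs Q"
    have "rzero R (tail Q a) \<in> rspace R (tail Q a)" "rzero R (head Q a) \<in> L (head Q a)"
      using L a r(2) by auto
    then show "f1_linear (rspace (rep_quotient Q R L) (tail Q a)) (rzero (rep_quotient Q R L) (tail Q a))
      (rspace (rep_quotient Q R L) (head Q a)) (rzero (rep_quotient Q R L) (head Q a))
      (rmap (rep_quotient Q R L) a)"
      using r(3-5)[OF a] unfolding f1_linear_def inj_on_def
      by (auto simp: rep_quotient_def)
  qed
  have "rzero R (tail Q a) \<in> L (tail Q a)" "rzero R (head Q a) \<in> L (head Q a)" if "a \<in> arcs Q" for a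
    using L that by auto
  then show "coeff_quiver Q (rep_quotient Q R L) =
           sub_quiver Q (coeff_quiver Q R) (fst (coeff_quiver Q R) - S)"
    unfolding coeff_quiver_def sub_quiver_def rep_quotient_def S_def
    using L r(3) by (auto split: if_splits)
qed

text \<open>
  Subrepresentations are the sets of points that no arrow leaves; the quotient has the complement
  as its set of points, because every map into the subrepresentation becomes zero.
\<close>

lemma hall_number_eq:
  assumes Q: "fin_digraph Q" and M: "f1_representation Q M" and N: "f1_representation Q N"
    and R: "f1_representation Q R"
  shows "hall_number Q M N R =
    card {S \<in> splits Q (coeff_quiver Q M) (coeff_quiver Q N) (coeff_quiver Q R).
            outgoing Q (coeff_quiver Q R) S = {}}"
proof -
  interpret fin_digraph Q by fact
  note r = f1_repD[OF R]
  let ?K = "coeff_quiver Q R"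
  define pts where "pts L = {(v, x). v \<in> verts Q \<and> x \<in> L v \<and> x \<noteq> rzero R v}" for L
  define ideal where "ideal S v = (if v \<in> verts Q then insert (rzero R v) {x. (v, x) \<in> S} else {})"
    for S v
  have ideal_pts: "ideal (pts L) = L" if "L \<in> subreps Q R" for L
    using that by (fastforce simp: ideal_def pts_def subreps_def fun_eq_iff)
  have pts_ideal: "pts (ideal S) = S" if "S \<subseteq> fst ?K" for S
    using that by (force simp: ideal_def pts_def coeff_quiver_def)
  have pts_sub: "pts L \<subseteq> fst ?K" if "L \<in> subreps Q R" for L
    using that by (auto simp: pts_def subreps_def coeff_quiver_def)
  have out_pts: "outgoing Q ?K (pts L) = {}" if "L \<in> subreps Q R" for L
    using that by (auto simp: pts_def subreps_def coeff_quiver_def outgoing_def image_subset_iff)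
  have ideal_sub: "ideal S \<in> subreps Q R" if S: "S \<subseteq> fst ?K" and out: "outgoing Q ?K S = {}" for S
    unfolding subreps_def
  proof (intro CollectI conjI ballI allI impI)
    fix v assume "v \<in> verts Q"
    then show "rzero R v \<in> ideal S v" "ideal S v \<subseteq> rspace R v"
      using S r(2) by (auto simp: ideal_def coeff_quiver_def)
  next
    fix v assume "v \<notin> verts Q" then show "ideal S v = {}" by (simp add: ideal_def)
  next
    fix a assume a: "a \<in> arcs Q"
    show "rmap R a ` ideal S (tail Q a) \<subseteq> ideal S (head Q a)"
    proof
      fix y assume "y \<in> rmap R a ` ideal S (tail Q a)"
      then obtain x where x: "y = rmap R a x" "x = rzero R (tail Q a) \<or> (tail Q a, x) \<in> S"
        using a by (auto simp: ideal_def)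
      show "y \<in> ideal S (head Q a)"
      proof (cases "y = rzero R (head Q a)")
        case True then show ?thesis using a by (simp add: ideal_def)
      next
        case False
        then have xS: "(tail Q a, x) \<in> S" using x r(4)[OF a] by auto
        then have "(a, x, y) \<in> snd ?K" using S False x a by (auto simp: coeff_quiver_def)
        then have "(head Q a, y) \<in> S" using out xS by (auto simp: outgoing_def)
        then show ?thesis using a by (simp add: ideal_def)
      qed
    qed
  qed
  have iso: "rep_iso Q (rep_restrict R L) N \<and> rep_iso Q (rep_quotient Q R L) M \<longleftrightarrow>
      pts L \<in> splits Q (coeff_quiver Q M) (coeff_quiver Q N) ?K" if L: "L \<in> subreps Q R" for L
    using coeff_quiver_restrict(2)[OF Q R L] coeff_quiver_quotient(2)[OF Q R L] pts_sub[OF L]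
      rep_iso_iff_graph_iso[OF Q coeff_quiver_restrict(1)[OF Q R L] N]
      rep_iso_iff_graph_iso[OF Q coeff_quiver_quotient(1)[OF Q R L] M]
    by (simp add: splits_def pts_def)
  have eq: "{L \<in> subreps Q R. rep_iso Q (rep_restrict R L) N \<and> rep_iso Q (rep_quotient Q R L) M} =
      {L \<in> subreps Q R. pts L \<in> splits Q (coeff_quiver Q M) (coeff_quiver Q N) ?K}"
    using iso by blast
  have spl: "S \<subseteq> fst ?K" if "S \<in> splits Q (coeff_quiver Q M) (coeff_quiver Q N) ?K" for S
    using that by (simp add: splits_def)
  have "bij_betw pts {L \<in> subreps Q R. pts L \<in> splits Q (coeff_quiver Q M) (coeff_quiver Q N) ?K}
     {S \<in> splits Q (coeff_quiver Q M) (coeff_quiver Q N) ?K. outgoing Q ?K S = {}}"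
    by (rule bij_betw_byWitness[where f' = ideal])
      (auto simp: ideal_pts out_pts pts_ideal spl ideal_sub)
  then show ?thesis unfolding hall_number_def eq by (rule bij_betw_same_card)
qed

text \<open>
  For finite graphs this excludes directed cycles. A set in which every point has a successor is
  a more convenient witness than a cycle when counting arrows and when passing to subgraphs.
\<close>

definition nilpotent_quiver :: "('v, 'a) pre_digraph \<Rightarrow> ('v, 'a, 'x) arrow_graph \<Rightarrow> bool" where
  "nilpotent_quiver Q G \<longleftrightarrow>
     (\<forall>Z\<subseteq>fst G. (\<forall>z\<in>Z. \<exists>e\<in>snd G. src Q e = z \<and> tgt Q e \<in> Z) \<longrightarrow> Z = {})"

text \<open>
  Arbitrarily long nonzero composites start at the points of a set in which every point has a
  successor. Conversely, the sets of points at which a directed walk of length \<open>n\<close> starts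
  decrease with \<open>n\<close>; by finiteness they become stationary, and the stationary set has this property,
  hence is empty.
\<close>

lemma rep_nilpotent_iff:
  assumes "fin_digraph Q" "f1_representation Q M"
  shows "rep_nilpotent Q M \<longleftrightarrow> nilpotent_quiver Q (coeff_quiver Q M)"
proof -
  interpret fin_digraph Q by fact
  note m = f1_repD[OF assms(2)]
  let ?P = "fst (coeff_quiver Q M)" and ?E = "snd (coeff_quiver Q M)"
  show ?thesis
  proof
    assume "rep_nilpotent Q M"
    then obtain N where "\<forall>n\<ge>N. \<forall>u p v. awalk u p v \<and> length p = n \<longrightarrow>
        (\<forall>x\<in>rspace M u. fold (rmap M) p x = rzero M v)"
      unfolding rep_nilpotent_def by (elim exE)
    then have N: "fold (rmap M) p x = rzero M v"
      if "awalk u p v" "length p = N" "x \<in> rspace M u" for u p v x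
      using that by (metis le_refl)
    show "nilpotent_quiver Q (coeff_quiver Q M)"
      unfolding nilpotent_quiver_def
    proof (intro allI impI)
      fix Z assume Z: "Z \<subseteq> ?P" "\<forall>z\<in>Z. \<exists>e\<in>?E. src Q e = z \<and> tgt Q e \<in> Z"
      have walk: "\<exists>p v. awalk u p v \<and> length p = n \<and> fold (rmap M) p x \<noteq> rzero M v"
        if "(u, x) \<in> Z" for u x n
        using that
      proof (induction n arbitrary: u x)
        case 0
        then have "u \<in> verts Q" "x \<noteq> rzero M u" using Z by (auto simp: coeff_quiver_def)
        then show ?case by (intro exI[of _ "[]"] exI[of _ u]) (simp add: awalk_Nil_iff)
      next
        case (Suc n)
        then obtain e where e: "e \<in> ?E" "src Q e = (u, x)" "tgt Q e \<in> Z" using Z by blast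
        then obtain a y where a: "a \<in> arcs Q" "tail Q a = u" "y = rmap M a x" "(head Q a, y) \<in> Z"
          by (cases e) (auto simp: coeff_quiver_def)
        obtain p v where "awalk (head Q a) p v" "length p = n" "fold (rmap M) p y \<noteq> rzero M v"
          using Suc.IH[OF a(4)] by blast
        then show ?case using a by (intro exI[of _ "a # p"] exI[of _ v]) (simp add: awalk_Cons_iff)
      qed
      show "Z = {}"
      proof (rule ccontr)
        assume "Z \<noteq> {}"
        then obtain u x where ux: "(u, x) \<in> Z" by fastforce
        then have "x \<in> rspace M u" using Z by (auto simp: coeff_quiver_def)
        then show False using walk[OF ux, of N] N by blast
      qed
    qed
  next
    assume nil: "nilpotent_quiver Q (coeff_quiver Q M)"
    define Y where "Y n = ((\<lambda>Z. {z \<in> ?P. \<exists>e\<in>?E. src Q e = z \<and> tgt Q e \<in> Z}) ^^ n) ?P" for n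
    have Y0: "Y 0 = ?P" and YS: "Y (Suc n) = {z \<in> ?P. \<exists>e\<in>?E. src Q e = z \<and> tgt Q e \<in> Y n}" for n
      by (simp_all add: Y_def)
    have YP: "Y n \<subseteq> ?P" for n by (cases n) (auto simp: Y0 YS)
    have dec: "Y (Suc n) \<subseteq> Y n" for n
    proof (induction n)
      case (Suc n) then show ?case unfolding YS[of "Suc n"] YS[of n] by blast
    qed (simp add: Y0 YS)
    have fin: "finite (Y n)" for n
      using YP[of n] windingD(1)[OF winding_coeff_quiver[OF assms]] finite_subset by blast
    \<comment> \<open>The sequence is stationary from an index of least cardinality on.\<close>
    obtain N where N: "\<And>n. card (Y N) \<le> card (Y n)"
      using ex_has_least_nat[of "\<lambda>_. True" 0 "\<lambda>n. card (Y n)"] by auto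
    have "Y (Suc N) = Y N" using card_subset_eq[OF fin dec] N[of "Suc N"] card_mono[OF fin dec] by (metis le_antisym)
    then have "\<forall>z\<in>Y N. \<exists>e\<in>?E. src Q e = z \<and> tgt Q e \<in> Y N" using YS[of N] by blast
    then have YN: "Y N = {}" using nil YP[of N] unfolding nilpotent_quiver_def by blast
    have walk: "(u, x) \<in> Y (length p)"
      if "awalk u p v" "x \<in> rspace M u" "fold (rmap M) p x \<noteq> rzero M v" for u p v x
      using that
    proof (induction p arbitrary: u x)
      case Nil
      then show ?case by (auto simp: Y0 coeff_quiver_def awalk_Nil_iff)
    next
      case (Cons a p)
      then have a: "a \<in> arcs Q" "tail Q a = u" "awalk (head Q a) p v" by (auto simp: awalk_Cons_iff)
      have y: "(head Q a, rmap M a x) \<in> Y (length p)"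
        using Cons a m(3) by (intro Cons.IH) auto
      then have "rmap M a x \<noteq> rzero M (head Q a)" using YP by (force simp: coeff_quiver_def)
      moreover from this have "x \<noteq> rzero M u" using m(4)[OF a(1)] a by auto
      ultimately have "(a, x, rmap M a x) \<in> ?E" "(u, x) \<in> ?P"
        using a Cons.prems by (auto simp: coeff_quiver_def)
      then show ?case using y a by (force simp: YS)
    qed
    show "rep_nilpotent Q M"
      unfolding rep_nilpotent_def
    proof (intro exI[of _ N] allI impI ballI)
      fix n u p v x assume h: "N \<le> n" "awalk u p v \<and> length p = n" "x \<in> rspace M u"
      have "Y n \<subseteq> Y N" using dec h(1) by (rule lift_Suc_antimono_le)
      then show "fold (rmap M) p x = rzero M v" using walk[of u p v x] h YN by auto
    qed
  qed
qed

section \<open>Direct sums\<close>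

lemma graph_iso_glue:
  assumes S: "S \<subseteq> fst G" "links Q G S = {}" and T: "T \<subseteq> fst H" "links Q H T = {}"
    and w: "winding Q G" "winding Q H"
    and iso: "graph_iso Q (sub_quiver Q G S) (sub_quiver Q H T)"
      "graph_iso Q (sub_quiver Q G (fst G - S)) (sub_quiver Q H (fst H - T))"
  shows "graph_iso Q G H"
proof -
  let ?S = "fst G - S" and ?T = "fst H - T"
  obtain \<phi> \<psi> where i: "iso_by Q \<phi> (sub_quiver Q G S) (sub_quiver Q H T)"
    "iso_by Q \<psi> (sub_quiver Q G ?S) (sub_quiver Q H ?T)"
    using iso unfolding graph_iso_def by blast
  define \<theta> where "\<theta> v x = (if (v, x) \<in> S then \<phi> v x else \<psi> v x)" for v x
  have p1: "pmap \<theta> q = pmap \<phi> q" if "q \<in> S" for q using that by (cases q) (auto simp: pmap_def \<theta>_def)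
  have p2: "pmap \<theta> q = pmap \<psi> q" if "q \<in> ?S" for q using that by (cases q) (auto simp: pmap_def \<theta>_def)
  have G: "snd G = snd (sub_quiver Q G S) \<union> snd (sub_quiver Q G ?S)"
    using S winding_src_tgt[OF w(1)] unfolding sub_quiver_def outgoing_def incoming_def snd_conv
    by blast
  have H: "snd H = snd (sub_quiver Q H T) \<union> snd (sub_quiver Q H ?T)"
    using T winding_src_tgt[OF w(2)] unfolding sub_quiver_def outgoing_def incoming_def snd_conv
    by blast
  have a1: "amap Q \<theta> e = amap Q \<phi> e" if "e \<in> snd (sub_quiver Q G S)" for e
    using that by (intro arrow_eqI[where Q = Q]) (auto simp: sub_quiver_def p1)
  have a2: "amap Q \<theta> e = amap Q \<psi> e" if "e \<in> snd (sub_quiver Q G ?S)" for e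
    using that p2 by (intro arrow_eqI[where Q = Q]) (auto simp: sub_quiver_def)
  have "bij_betw (pmap \<theta>) S T" "bij_betw (pmap \<theta>) ?S ?T"
    using i bij_betw_cong[of S "pmap \<theta>" "pmap \<phi>"] bij_betw_cong[of ?S "pmap \<theta>" "pmap \<psi>"] p1 p2
    by (auto simp: iso_by_def)
  then have "bij_betw (pmap \<theta>) (S \<union> ?S) (T \<union> ?T)" by (rule bij_betw_combine) blast
  then have "bij_betw (pmap \<theta>) (fst G) (fst H)" using S T by (simp add: Un_absorb1)
  moreover have "snd H = amap Q \<theta> ` snd G"
  proof -
    have "amap Q \<theta> ` snd (sub_quiver Q G S) = snd (sub_quiver Q H T)"
      using i(1) a1 by (simp add: iso_by_def cong: image_cong)
    moreover have "amap Q \<theta> ` snd (sub_quiver Q G ?S) = snd (sub_quiver Q H ?T)"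
      using i(2) a2 by (simp add: iso_by_def cong: image_cong)
    ultimately show ?thesis unfolding G H image_Un by simp
  qed
  ultimately show ?thesis unfolding graph_iso_def iso_by_def by blast
qed

lemma f1_representation_rep_sum:
  assumes "fin_digraph Q" "f1_representation Q M" "f1_representation Q N"
  shows "f1_representation Q (rep_sum M N)"
proof -
  interpret fin_digraph Q by fact
  note m = f1_repD[OF assms(2)] and n = f1_repD[OF assms(3)]
  show ?thesis
    unfolding f1_representation_def
  proof (intro conjI ballI)
    fix v assume "v \<in> verts Q"
    then show "f1_space (rspace (rep_sum M N) v) (rzero (rep_sum M N) v)"
      using m n by (auto simp: f1_space_def rep_sum_def)
  next
    fix a assume a: "a \<in> arcs Q"
    show "f1_linear (rspace (rep_sum M N) (tail Q a)) (rzero (rep_sum M N) (tail Q a))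
      (rspace (rep_sum M N) (head Q a)) (rzero (rep_sum M N) (head Q a)) (rmap (rep_sum M N) a)"
      using m(2)[of "tail Q a"] n(2)[of "tail Q a"] m(3-5)[OF a] n(3-5)[OF a] a
      unfolding f1_linear_def inj_on_def
      by (auto simp: rep_sum_def)
  qed
qed

lemma coeff_quiver_rep_sum:
  assumes Q: "fin_digraph Q" and M: "f1_representation Q M" and N: "f1_representation Q N"
  obtains S where "S \<subseteq> fst (coeff_quiver Q (rep_sum M N))"
    "links Q (coeff_quiver Q (rep_sum M N)) S = {}"
    "graph_iso Q (coeff_quiver Q M) (sub_quiver Q (coeff_quiver Q (rep_sum M N)) S)"
    "graph_iso Q (coeff_quiver Q N)
       (sub_quiver Q (coeff_quiver Q (rep_sum M N)) (fst (coeff_quiver Q (rep_sum M N)) - S))"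
proof
  interpret fin_digraph Q by fact
  note m = f1_repD[OF M] and n = f1_repD[OF N]
  let ?H = "coeff_quiver Q (rep_sum M N)"
  let ?S = "{(v, x, y). v \<in> verts Q \<and> x \<in> rspace M v \<and> x \<noteq> rzero M v \<and> y = rzero N v}"
  have r: "rzero M v \<in> rspace M v" "rzero N v \<in> rspace N v" if "v \<in> verts Q" for v
    using that m(2) n(2) by auto
  show S: "?S \<subseteq> fst ?H" by (auto simp: coeff_quiver_def rep_sum_def)
  have T: "fst ?H - ?S = {(v, x, y). v \<in> verts Q \<and> x = rzero M v \<and> y \<in> rspace N v \<and> y \<noteq> rzero N v}"
    using r by (auto simp: coeff_quiver_def rep_sum_def)
  show "links Q ?H ?S = {}"
    using m(3,4) n(3,4) by (auto simp: coeff_quiver_def rep_sum_def outgoing_def incoming_def)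
  have "iso_by Q (\<lambda>v x. (x, rzero N v)) (coeff_quiver Q M) (sub_quiver Q ?H ?S)"
    unfolding iso_by_def
  proof
    show "bij_betw (pmap (\<lambda>v x. (x, rzero N v))) (fst (coeff_quiver Q M)) (fst (sub_quiver Q ?H ?S))"
      unfolding bij_betw_def inj_on_def by (auto simp: pmap_def coeff_quiver_def image_iff)
    show "snd (sub_quiver Q ?H ?S) = amap Q (\<lambda>v x. (x, rzero N v)) ` snd (coeff_quiver Q M)"
      using m(3) n(4)
      by (force simp: amap_def sub_quiver_def coeff_quiver_def rep_sum_def image_iff)
  qed
  then show "graph_iso Q (coeff_quiver Q M) (sub_quiver Q ?H ?S)" unfolding graph_iso_def by blast
  have "iso_by Q (\<lambda>v y. (rzero M v, y)) (coeff_quiver Q N) (sub_quiver Q ?H (fst ?H - ?S))"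
    unfolding iso_by_def T
  proof
    let ?T = "{(v, x, y). v \<in> verts Q \<and> x = rzero M v \<and> y \<in> rspace N v \<and> y \<noteq> rzero N v}"
    show "bij_betw (pmap (\<lambda>v y. (rzero M v, y))) (fst (coeff_quiver Q N)) (fst (sub_quiver Q ?H ?T))"
      unfolding bij_betw_def inj_on_def by (auto simp: pmap_def coeff_quiver_def image_iff)
    show "snd (sub_quiver Q ?H ?T) = amap Q (\<lambda>v y. (rzero M v, y)) ` snd (coeff_quiver Q N)"
      using n(3) m(4)
      by (force simp: amap_def sub_quiver_def coeff_quiver_def rep_sum_def image_iff)
  qed
  then show "graph_iso Q (coeff_quiver Q N) (sub_quiver Q ?H (fst ?H - ?S))"
    unfolding graph_iso_def by blast
qed

section \<open>Connectedness and the Euler characteristic\<close>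

definition connected_quiver :: "('v, 'a) pre_digraph \<Rightarrow> ('v, 'a, 'x) arrow_graph \<Rightarrow> bool" where
  "connected_quiver Q G \<longleftrightarrow>
     fst G \<noteq> {} \<and> (\<forall>S\<subseteq>fst G. links Q G S = {} \<longrightarrow> S = {} \<or> S = fst G)"

definition euler_char :: "('v, 'a, 'x) arrow_graph \<Rightarrow> int" where
  "euler_char G = int (card (fst G)) - int (card (snd G))"

lemma links_compl:
  assumes "winding Q G" "S \<subseteq> fst G"
  shows "outgoing Q G (fst G - S) = incoming Q G S" "incoming Q G (fst G - S) = outgoing Q G S"
  using assms winding_src_tgt[OF assms(1)] unfolding outgoing_def incoming_def by blast+

lemma arrows_partition:
  assumes "winding Q G" "S \<subseteq> fst G"
  shows "snd G = snd (sub_quiver Q G S) \<union> snd (sub_quiver Q G (fst G - S)) \<union> links Q G S"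
    "snd (sub_quiver Q G S) \<inter> snd (sub_quiver Q G (fst G - S)) = {}"
    "(snd (sub_quiver Q G S) \<union> snd (sub_quiver Q G (fst G - S))) \<inter> links Q G S = {}"
  using assms winding_src_tgt[OF assms(1)]
  unfolding outgoing_def incoming_def sub_quiver_def snd_conv by blast+

lemma finite_arrows_sub_quiver:
  assumes "winding Q G" "finite (arcs Q)"
  shows "finite (snd (sub_quiver Q G S))" "finite (links Q G S)"
proof -
  have "finite (snd G)" by (rule finite_winding_arrows[OF assms])
  then show "finite (snd (sub_quiver Q G S))" "finite (links Q G S)"
    by (auto simp: sub_quiver_def outgoing_def incoming_def)
qed

lemma euler_char_split:
  assumes "winding Q G" "finite (arcs Q)" "S \<subseteq> fst G"
  shows "euler_char G =
    euler_char (sub_quiver Q G S) + euler_char (sub_quiver Q G (fst G - S)) - int (card (links Q G S))"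
proof -
  note p = arrows_partition[OF assms(1,3)] and f = finite_arrows_sub_quiver[OF assms(1,2)]
  have card_Un3: "card (A \<union> B \<union> C) = card A + card B + card C"
    if "finite A" "finite B" "finite C" "A \<inter> B = {}" "(A \<union> B) \<inter> C = {}"
    for A B C :: "('b \<times> 'c \<times> 'c) set"
    using that by (simp add: card_Un_disjoint)
  have "card (snd G) = card (snd (sub_quiver Q G S)) + card (snd (sub_quiver Q G (fst G - S)))
      + card (links Q G S)"
    using card_Un3[OF f(1) f(1) f(2) p(2,3)] p(1) by metis
  moreover have "card (fst G) = card S + card (fst G - S)"
    using windingD(1)[OF assms(1)] assms(3)
    by (metis card_Diff_subset card_mono finite_subset le_add_diff_inverse)
  ultimately show ?thesis by (simp add: euler_char_def)
qed

text \<open>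
  If the missing points are added one at a time, always choosing a point linked to the present
  ones, each step adds one point and at least one arrow.
\<close>

lemma euler_char_le_sub_quiver:
  assumes w: "winding Q G" and fin: "finite (arcs Q)" and c: "connected_quiver Q G"
    and "Y \<subseteq> fst G" "Y \<noteq> {}"
  shows "euler_char G \<le> euler_char (sub_quiver Q G Y)"
  using assms(4,5)
proof (induction "card (fst G - Y)" arbitrary: Y rule: less_induct)
  case less
  note P = windingD(1)[OF w]
  show ?case
  proof (cases "Y = fst G")
    case True
    then show ?thesis using sub_quiver_all[OF w] by simp
  next
    case False
    then obtain e where e: "e \<in> links Q G Y" using c less.prems unfolding connected_quiver_def by blast
    define q where "q = (if src Q e \<in> Y then tgt Q e else src Q e)"
    have q: "q \<notin> Y" "q \<in> fst G" "src Q e \<in> insert q Y" "tgt Q e \<in> insert q Y" "e \<in> snd G"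
      "e \<notin> snd (sub_quiver Q G Y)"
      using e winding_src_tgt(1,2)[OF w, of e] by (auto simp: q_def outgoing_def incoming_def sub_quiver_def)
    have "card (fst G - insert q Y) < card (fst G - Y)"
      using q P by (intro psubset_card_mono) auto
    then have "euler_char G \<le> euler_char (sub_quiver Q G (insert q Y))"
      using less q by auto
    also have "insert e (snd (sub_quiver Q G Y)) \<subseteq> snd (sub_quiver Q G (insert q Y))"
      using q by (auto simp: sub_quiver_def)
    then have "card (insert e (snd (sub_quiver Q G Y))) \<le> card (snd (sub_quiver Q G (insert q Y)))"
      by (intro card_mono finite_arrows_sub_quiver[OF w fin])
    then have "card (snd (sub_quiver Q G Y)) + 1 \<le> card (snd (sub_quiver Q G (insert q Y)))"
      using q finite_arrows_sub_quiver[OF w fin] by simp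
    then have "euler_char (sub_quiver Q G (insert q Y)) \<le> euler_char (sub_quiver Q G Y)"
      using q P less.prems finite_subset[of Y "fst G"] by (simp add: euler_char_def)
    finally show ?thesis .
  qed
qed

lemma euler_char_le_1:
  assumes "winding Q G" "finite (arcs Q)" "connected_quiver Q G"
  shows "euler_char G \<le> 1"
proof -
  obtain q where "q \<in> fst G" using assms(3) unfolding connected_quiver_def by blast
  then have "euler_char G \<le> euler_char (sub_quiver Q G {q})"
    using assms by (intro euler_char_le_sub_quiver) auto
  then show ?thesis by (simp add: euler_char_def)
qed

text \<open>
  A connected graph of Euler characteristic \<open>1\<close> is a tree, so it has no directed cycle: a set \<open>Z\<close>
  in which every point has a successor spans at least as many arrows as it has points, and the
  Euler characteristic of the whole graph would be at most \<open>0\<close>.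
\<close>

lemma nilpotent_if_euler_char_1:
  assumes w: "winding Q G" "finite (arcs Q)" "connected_quiver Q G" and "euler_char G = 1"
  shows "nilpotent_quiver Q G"
  unfolding nilpotent_quiver_def
proof (intro allI impI)
  fix Z assume Z: "Z \<subseteq> fst G" "\<forall>z\<in>Z. \<exists>e\<in>snd G. src Q e = z \<and> tgt Q e \<in> Z"
  show "Z = {}"
  proof (rule ccontr)
    assume "Z \<noteq> {}"
    then have "1 \<le> euler_char (sub_quiver Q G Z)"
      using euler_char_le_sub_quiver[OF w Z(1)] assms(4) by simp
    moreover have "Z \<subseteq> src Q ` snd (sub_quiver Q G Z)"
    proof
      fix z assume z: "z \<in> Z"
      then obtain e where "e \<in> snd G" "src Q e = z" "tgt Q e \<in> Z" using Z(2) by blast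
      then show "z \<in> src Q ` snd (sub_quiver Q G Z)"
        using z by (intro image_eqI[of _ _ e]) (auto simp: sub_quiver_def)
    qed
    then have "card Z \<le> card (snd (sub_quiver Q G Z))"
      using finite_arrows_sub_quiver[OF w(1,2)] surj_card_le by blast
    ultimately show False by (simp add: euler_char_def)
  qed
qed

section \<open>The structure constants of the commutator\<close>

text \<open>
  This is \<open>1\<close> if all linking arrows enter \<open>S\<close> and there is at least one, \<open>-1\<close> if all of them leave
  \<open>S\<close> and there is at least one, and \<open>0\<close> otherwise: splittings without linking arrows contribute
  equally to both products in a commutator.
\<close>

definition split_sign ::
  "('v, 'a) pre_digraph \<Rightarrow> ('v, 'a, 'x) arrow_graph \<Rightarrow> ('v \<times> 'x) set \<Rightarrow> int" where
  "split_sign Q G S = of_bool (outgoing Q G S = {}) - of_bool (incoming Q G S = {})"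

definition bracket_number ::
  "('v, 'a) pre_digraph \<Rightarrow> ('v, 'a, 'x) arrow_graph \<Rightarrow> ('v, 'a, 'y) arrow_graph \<Rightarrow>
     ('v, 'a, 'z) arrow_graph \<Rightarrow> int" where
  "bracket_number Q G H K = (\<Sum>S\<in>splits Q G H K. split_sign Q K S)"

lemma splits_subset: "S \<in> splits Q G H K \<Longrightarrow> S \<subseteq> fst K"
  by (simp add: splits_def)

lemma finite_splits:
  assumes "winding Q K"
  shows "finite (splits Q G H K)"
  using windingD(1)[OF assms] by (auto simp: splits_def intro: finite_subset[of _ "Pow (fst K)"])

lemma splits_compl:
  assumes "S \<in> splits Q G H K"
  shows "fst K - S \<in> splits Q H G K"
  using assms by (auto simp: splits_def double_diff)

text \<open>
  Taking complements turns the subrepresentations isomorphic to \<open>M\<close> with quotient \<open>N\<close> into the sets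
  isomorphic to \<open>N\<close> with complement \<open>M\<close> that no arrow enters.
\<close>

lemma hall_number_diff:
  assumes Q: "fin_digraph Q" and r: "f1_representation Q M" "f1_representation Q N" "f1_representation Q R"
  shows "int (hall_number Q M N R) - int (hall_number Q N M R) =
    bracket_number Q (coeff_quiver Q M) (coeff_quiver Q N) (coeff_quiver Q R)"
proof -
  let ?G = "coeff_quiver Q M" and ?H = "coeff_quiver Q N" and ?K = "coeff_quiver Q R"
  have w: "winding Q ?K" by (rule winding_coeff_quiver[OF Q r(3)])
  have "bij_betw (\<lambda>S. fst ?K - S) {S \<in> splits Q ?H ?G ?K. outgoing Q ?K S = {}}
      {S \<in> splits Q ?G ?H ?K. incoming Q ?K S = {}}"
    by (rule bij_betw_byWitness[where f' = "\<lambda>S. fst ?K - S"])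
      (auto simp: splits_compl links_compl[OF w] splits_subset double_diff dest: subsetD[OF splits_subset])
  then have "card {S \<in> splits Q ?H ?G ?K. outgoing Q ?K S = {}} =
      card {S \<in> splits Q ?G ?H ?K. incoming Q ?K S = {}}"
    by (rule bij_betw_same_card)
  then show ?thesis
    using finite_splits[OF w, of ?G ?H]
    by (simp add: hall_number_eq[OF Q] r bracket_number_def split_sign_def sum_subtractf
        of_bool_def sum.If_cases Int_def)
qed

section \<open>Invariance under isomorphism\<close>

lemma iso_by_mem:
  assumes "iso_by Q \<phi> G H" "q \<in> fst G" "S \<subseteq> fst G"
  shows "pmap \<phi> q \<in> pmap \<phi> ` S \<longleftrightarrow> q \<in> S"
  using assms by (auto simp: iso_by_def bij_betw_def dest: inj_onD)

lemma Collect_image: "{x \<in> f ` A. P x} = f ` {x \<in> A. P (f x)}"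
  by auto

lemma iso_by_outgoing:
  assumes "winding Q G" "iso_by Q \<phi> G H" "S \<subseteq> fst G"
  shows "outgoing Q H (pmap \<phi> ` S) = amap Q \<phi> ` outgoing Q G S"
    "incoming Q H (pmap \<phi> ` S) = amap Q \<phi> ` incoming Q G S"
proof -
  have e: "snd H = amap Q \<phi> ` snd G" using assms(2) by (simp add: iso_by_def)
  note m = iso_by_mem[OF assms(2) winding_src_tgt(1)[OF assms(1)] assms(3)]
    iso_by_mem[OF assms(2) winding_src_tgt(2)[OF assms(1)] assms(3)]
  show "outgoing Q H (pmap \<phi> ` S) = amap Q \<phi> ` outgoing Q G S"
    unfolding outgoing_def e Collect_image by (simp add: m cong: conj_cong)
  show "incoming Q H (pmap \<phi> ` S) = amap Q \<phi> ` incoming Q G S"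
    unfolding incoming_def e Collect_image by (simp add: m cong: conj_cong)
qed

lemma iso_by_sub_quiver:
  assumes "winding Q G" "iso_by Q \<phi> G H" "S \<subseteq> fst G"
  shows "iso_by Q \<phi> (sub_quiver Q G S) (sub_quiver Q H (pmap \<phi> ` S))"
proof -
  have e: "snd H = amap Q \<phi> ` snd G" using assms(2) by (simp add: iso_by_def)
  note m = iso_by_mem[OF assms(2) winding_src_tgt(1)[OF assms(1)] assms(3)]
    iso_by_mem[OF assms(2) winding_src_tgt(2)[OF assms(1)] assms(3)]
  have "snd (sub_quiver Q H (pmap \<phi> ` S)) = amap Q \<phi> ` snd (sub_quiver Q G S)"
    unfolding sub_quiver_def snd_conv e Collect_image by (simp add: m cong: conj_cong)
  moreover have "inj_on (pmap \<phi>) S"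
    using assms(2,3) unfolding iso_by_def bij_betw_def by (blast intro: inj_on_subset)
  ultimately show ?thesis unfolding iso_by_def by (simp add: bij_betw_def)
qed

lemma iso_by_subset:
  assumes "iso_by Q \<phi> G H" "T \<subseteq> fst H"
  obtains S where "S \<subseteq> fst G" "T = pmap \<phi> ` S"
  using assms by (metis bij_betw_imp_surj_on iso_by_def subset_imageE)

lemma iso_by_compl:
  assumes "iso_by Q \<phi> G H" "S \<subseteq> fst G"
  shows "pmap \<phi> ` (fst G - S) = fst H - pmap \<phi> ` S"
  using assms inj_on_image_set_diff[of "pmap \<phi>" "fst G" "fst G" S]
  by (auto simp: iso_by_def bij_betw_def)

lemma iso_by_connected:
  assumes "winding Q G" "iso_by Q \<phi> G H" "connected_quiver Q G"
  shows "connected_quiver Q H"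
  unfolding connected_quiver_def
proof (intro conjI allI impI)
  have H: "fst H = pmap \<phi> ` fst G" using assms(2) by (simp add: iso_by_def bij_betw_def)
  then show "fst H \<noteq> {}" using assms(3) by (simp add: connected_quiver_def)
  fix T assume T: "T \<subseteq> fst H" "links Q H T = {}"
  obtain S where S: "S \<subseteq> fst G" "T = pmap \<phi> ` S" using iso_by_subset[OF assms(2) T(1)] .
  then have "links Q G S = {}" using T iso_by_outgoing[OF assms(1,2) S(1)] by simp
  then show "T = {} \<or> T = fst H" using S assms(3) H by (auto simp: connected_quiver_def)
qed

lemma graph_iso_connected:
  assumes "winding Q G" "graph_iso Q G H"
  shows "connected_quiver Q G \<longleftrightarrow> connected_quiver Q H"
proof
  show "connected_quiver Q G \<Longrightarrow> connected_quiver Q H"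
    using assms iso_by_connected unfolding graph_iso_def by blast
next
  assume H: "connected_quiver Q H"
  obtain \<phi> where \<phi>: "iso_by Q \<phi> G H" using assms(2) unfolding graph_iso_def by blast
  show "connected_quiver Q G"
    unfolding connected_quiver_def
  proof (intro conjI allI impI)
    have fH: "fst H = pmap \<phi> ` fst G" using \<phi> by (simp add: iso_by_def bij_betw_def)
    then show "fst G \<noteq> {}" using H by (auto simp: connected_quiver_def)
    fix S assume S: "S \<subseteq> fst G" "links Q G S = {}"
    then have "links Q H (pmap \<phi> ` S) = {}" using iso_by_outgoing[OF assms(1) \<phi> S(1)] by simp
    moreover have "pmap \<phi> ` S \<subseteq> fst H" using S fH by auto
    ultimately have "pmap \<phi> ` S = {} \<or> pmap \<phi> ` S = pmap \<phi> ` fst G"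
      using H fH by (auto simp: connected_quiver_def)
    then show "S = {} \<or> S = fst G"
      using S iso_by_mem[OF \<phi> _ S(1)] by blast
  qed
qed

lemma graph_iso_euler_char:
  assumes "winding Q G" "graph_iso Q G H"
  shows "euler_char G = euler_char H"
proof -
  obtain \<phi> where \<phi>: "bij_betw (pmap \<phi>) (fst G) (fst H)" "snd H = amap Q \<phi> ` snd G"
    using assms unfolding graph_iso_def iso_by_def by blast
  have "card (snd H) = card (snd G)"
    using \<phi> card_image[OF inj_on_amap[OF assms(1), of \<phi>]] by (simp add: bij_betw_def)
  then show ?thesis using bij_betw_same_card[OF \<phi>(1)] by (simp add: euler_char_def)
qed

lemma graph_iso_nilpotent:
  assumes "winding Q G" "graph_iso Q G H" "nilpotent_quiver Q H"
  shows "nilpotent_quiver Q G"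
  unfolding nilpotent_quiver_def
proof (intro allI impI)
  obtain \<phi> where \<phi>: "bij_betw (pmap \<phi>) (fst G) (fst H)" "snd H = amap Q \<phi> ` snd G"
    using assms unfolding graph_iso_def iso_by_def by blast
  fix Z assume Z: "Z \<subseteq> fst G" "\<forall>z\<in>Z. \<exists>e\<in>snd G. src Q e = z \<and> tgt Q e \<in> Z"
  have "\<exists>e\<in>snd H. src Q e = z' \<and> tgt Q e \<in> pmap \<phi> ` Z" if z': "z' \<in> pmap \<phi> ` Z" for z'
  proof -
    obtain z where z: "z \<in> Z" "z' = pmap \<phi> z" using z' by blast
    then obtain e where "e \<in> snd G" "src Q e = z" "tgt Q e \<in> Z" using Z(2) by blast
    then show ?thesis using z \<phi>(2) by (intro bexI[of _ "amap Q \<phi> e"]) auto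
  qed
  moreover have "pmap \<phi> ` Z \<subseteq> fst H" using Z(1) \<phi>(1) by (auto simp: bij_betw_def)
  ultimately show "Z = {}" using assms(3) unfolding nilpotent_quiver_def by (metis image_is_empty)
qed

lemma nilpotent_sub_quiver:
  assumes "nilpotent_quiver Q G" "S \<subseteq> fst G"
  shows "nilpotent_quiver Q (sub_quiver Q G S)"
  unfolding nilpotent_quiver_def
proof (intro allI impI)
  fix Z assume Z: "Z \<subseteq> fst (sub_quiver Q G S)"
    "\<forall>z\<in>Z. \<exists>e\<in>snd (sub_quiver Q G S). src Q e = z \<and> tgt Q e \<in> Z"
  then have "Z \<subseteq> fst G" "\<forall>z\<in>Z. \<exists>e\<in>snd G. src Q e = z \<and> tgt Q e \<in> Z"
    using assms(2) unfolding sub_quiver_def fst_conv snd_conv by blast+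
  then show "Z = {}" using assms(1) unfolding nilpotent_quiver_def by blast
qed

lemma graph_iso_iff:
  assumes "winding Q G" "winding Q H" "graph_iso Q G G'" "graph_iso Q H H'"
  shows "graph_iso Q G H \<longleftrightarrow> graph_iso Q G' H'"
proof
  assume "graph_iso Q G H"
  then show "graph_iso Q G' H'"
    by (rule graph_iso_trans[OF graph_iso_trans[OF graph_iso_sym[OF assms(1,3)]] assms(4)])
next
  assume *: "graph_iso Q G' H'"
  have "graph_iso Q H' H" by (rule graph_iso_sym[OF assms(2,4)])
  then show "graph_iso Q G H" by (rule graph_iso_trans[OF graph_iso_trans[OF assms(3) *]])
qed

lemma bracket_number_cong:
  assumes w: "winding Q G" "winding Q H" "winding Q K"
    and i: "graph_iso Q G G'" "graph_iso Q H H'" "graph_iso Q K K'"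
  shows "bracket_number Q G H K = bracket_number Q G' H' K'"
proof -
  obtain \<phi> where \<phi>: "iso_by Q \<phi> K K'" using i(3) unfolding graph_iso_def by blast
  have K': "fst K' = pmap \<phi> ` fst K" and inj: "inj_on (pmap \<phi>) (fst K)"
    using \<phi> by (simp_all add: iso_by_def bij_betw_def)
  have sub: "graph_iso Q (sub_quiver Q K S) (sub_quiver Q K' (pmap \<phi> ` S))" if "S \<subseteq> fst K" for S
    using iso_by_sub_quiver[OF w(3) \<phi> that] unfolding graph_iso_def by blast
  have mem: "S \<in> splits Q G H K \<longleftrightarrow> pmap \<phi> ` S \<in> splits Q G' H' K'" if S: "S \<subseteq> fst K" for S
    using graph_iso_iff[OF winding_sub_quiver[OF w(3) S] w(2) sub[OF S] i(2)]
      graph_iso_iff[OF winding_sub_quiver[OF w(3) Diff_subset] w(1) sub[OF Diff_subset] i(1), of S]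
      S K' iso_by_compl[OF \<phi> S]
    by (auto simp: splits_def)
  show ?thesis
    unfolding bracket_number_def
  proof (rule sum.reindex_bij_witness[where j = "image (pmap \<phi>)" and i = "\<lambda>T. {q \<in> fst K. pmap \<phi> q \<in> T}"])
    fix S assume "S \<in> splits Q G H K"
    then have "S \<in> splits Q G H K" and S: "S \<subseteq> fst K" by (auto simp: splits_def)
    then show "pmap \<phi> ` S \<in> splits Q G' H' K'" using mem by blast
    show "{q \<in> fst K. pmap \<phi> q \<in> pmap \<phi> ` S} = S"
      using iso_by_mem[OF \<phi> _ S] S by blast
    show "split_sign Q K' (pmap \<phi> ` S) = split_sign Q K S"
      unfolding split_sign_def iso_by_outgoing[OF w(3) \<phi> S] by simp
  next
    fix T assume T: "T \<in> splits Q G' H' K'"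
    then have "T \<subseteq> pmap \<phi> ` fst K" using K' by (auto simp: splits_def)
    then show *: "pmap \<phi> ` {q \<in> fst K. pmap \<phi> q \<in> T} = T" by blast
    then show "{q \<in> fst K. pmap \<phi> q \<in> T} \<in> splits Q G H K"
      using mem[of "{q \<in> fst K. pmap \<phi> q \<in> T}"] T by auto
  qed
qed

lemma connected_sub_links:
  assumes "connected_quiver Q (sub_quiver Q K S)" "links Q K T = {}"
  shows "T \<inter> S = {} \<or> S \<subseteq> T"
proof -
  have "links Q (sub_quiver Q K S) (T \<inter> S) = {}"
    using assms(2) unfolding outgoing_def incoming_def sub_quiver_def snd_conv by blast
  then have "T \<inter> S = {} \<or> T \<inter> S = S"
    using assms(1) unfolding connected_quiver_def by auto
  then show ?thesis by blast
qed

text \<open>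
  If \<open>T\<close> is a nontrivial union of components, the connected sets \<open>S\<close> and \<open>fst K - S\<close> lie on one
  side of \<open>T\<close> each, so one of them equals \<open>T\<close>.
\<close>

lemma disconnected_no_links:
  assumes K: "winding Q K" "\<not> connected_quiver Q K" and S: "S \<subseteq> fst K"
    and c: "connected_quiver Q (sub_quiver Q K S)" "connected_quiver Q (sub_quiver Q K (fst K - S))"
  shows "links Q K S = {}"
proof -
  have "fst K \<noteq> {}" using c(1) S by (auto simp: connected_quiver_def)
  then obtain T where T: "T \<subseteq> fst K" "links Q K T = {}" "T \<noteq> {}" "T \<noteq> fst K"
    using K(2) unfolding connected_quiver_def by blast
  then have "T = S \<or> T = fst K - S"
    using connected_sub_links[OF c(1) T(2)] connected_sub_links[OF c(2) T(2)] S by blast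
  then show ?thesis using T(2) links_compl[OF K(1) S] by auto
qed

lemma splits_connected:
  assumes "winding Q K" "S \<in> splits Q G H K"
  shows "connected_quiver Q (sub_quiver Q K S) \<longleftrightarrow> connected_quiver Q H"
    "connected_quiver Q (sub_quiver Q K (fst K - S)) \<longleftrightarrow> connected_quiver Q G"
    "euler_char (sub_quiver Q K S) = euler_char H"
    "euler_char (sub_quiver Q K (fst K - S)) = euler_char G"
proof -
  have "S \<subseteq> fst K" and i: "graph_iso Q (sub_quiver Q K S) H" "graph_iso Q (sub_quiver Q K (fst K - S)) G"
    using assms(2) by (auto simp: splits_def)
  then have w: "winding Q (sub_quiver Q K S)" "winding Q (sub_quiver Q K (fst K - S))"
    using winding_sub_quiver[OF assms(1)] by auto
  show "connected_quiver Q (sub_quiver Q K S) \<longleftrightarrow> connected_quiver Q H"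
    "connected_quiver Q (sub_quiver Q K (fst K - S)) \<longleftrightarrow> connected_quiver Q G"
    "euler_char (sub_quiver Q K S) = euler_char H"
    "euler_char (sub_quiver Q K (fst K - S)) = euler_char G"
    using graph_iso_connected[OF w(1) i(1)] graph_iso_connected[OF w(2) i(2)]
      graph_iso_euler_char[OF w(1) i(1)] graph_iso_euler_char[OF w(2) i(2)] by auto
qed

lemma bracket_number_eq_0:
  assumes "\<And>S. S \<in> splits Q G H K \<Longrightarrow> links Q K S = {}"
  shows "bracket_number Q G H K = 0"
  unfolding bracket_number_def using assms by (intro sum.neutral) (auto simp: split_sign_def)

text \<open>
  This is the reason why commutators of primitive elements have no components on
  decomposable representations.
\<close>

lemma bracket_number_disconnected:
  assumes "winding Q K" "\<not> connected_quiver Q K" "connected_quiver Q G" "connected_quiver Q H"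
  shows "bracket_number Q G H K = 0"
  using assms by (intro bracket_number_eq_0 disconnected_no_links)
    (auto simp: splits_connected splits_subset)

section \<open>Reorienting the arrows\<close>

text \<open>
  Comparing tails detects the reversed arrows of two quivers with the same underlying graph, except
  for loops, which a change of orientation leaves alone.
\<close>

definition reverse_arrow ::
  "('v, 'a) pre_digraph \<Rightarrow> ('v, 'a) pre_digraph \<Rightarrow> 'a \<times> 'x \<times> 'x \<Rightarrow> 'a \<times> 'x \<times> 'x" where
  "reverse_arrow Q Q' = (\<lambda>(a, x, y). if tail Q' a = tail Q a then (a, x, y) else (a, y, x))"

definition reorient ::
  "('v, 'a) pre_digraph \<Rightarrow> ('v, 'a) pre_digraph \<Rightarrow> ('v, 'a, 'x) arrow_graph \<Rightarrow> ('v, 'a, 'x) arrow_graph" where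
  "reorient Q Q' G = (fst G, reverse_arrow Q Q' ` snd G)"

definition reversed ::
  "('v, 'a) pre_digraph \<Rightarrow> ('v, 'a) pre_digraph \<Rightarrow> ('a \<times> 'x \<times> 'x) set \<Rightarrow> ('a \<times> 'x \<times> 'x) set" where
  "reversed Q Q' E = {e \<in> E. tail Q' (fst e) \<noteq> tail Q (fst e)}"

definition reversal_sign ::
  "('v, 'a) pre_digraph \<Rightarrow> ('v, 'a) pre_digraph \<Rightarrow> ('v, 'a, 'x) arrow_graph \<Rightarrow> int" where
  "reversal_sign Q Q' G = (-1) ^ card (reversed Q Q' (snd G))"

lemma fst_reverse_arrow [simp]: "fst (reverse_arrow Q Q' e) = fst e"
  by (cases e) (simp add: reverse_arrow_def)

lemma reverse_arrow_reverse_arrow [simp]: "reverse_arrow Q' Q (reverse_arrow Q Q' e) = e"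
  by (cases e) (simp add: reverse_arrow_def)

lemma inj_reverse_arrow: "inj_on (reverse_arrow Q Q') E"
  by (rule inj_on_inverseI[of _ "reverse_arrow Q' Q"]) simp

lemma fst_reorient [simp]: "fst (reorient Q Q' G) = fst G"
  by (simp add: reorient_def)

lemma snd_reorient: "snd (reorient Q Q' G) = reverse_arrow Q Q' ` snd G"
  by (simp add: reorient_def)

lemma reorient_reorient [simp]: "reorient Q' Q (reorient Q Q' G) = G"
  by (simp add: reorient_def image_image)

lemma euler_char_reorient [simp]: "euler_char (reorient Q Q' G) = euler_char G"
  by (simp add: euler_char_def snd_reorient card_image inj_reverse_arrow)

lemma reversal_sign_reorient [simp]: "reversal_sign Q' Q (reorient Q Q' G) = reversal_sign Q Q' G"
proof -
  have "reversed Q' Q (snd (reorient Q Q' G)) = reverse_arrow Q Q' ` reversed Q Q' (snd G)"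
    by (auto simp: reversed_def snd_reorient)
  then show ?thesis by (simp add: reversal_sign_def card_image inj_reverse_arrow)
qed

lemma reversal_sign_square [simp]:
  "reversal_sign Q Q' G * reversal_sign Q Q' G = 1"
  by (simp add: reversal_sign_def flip: power_add mult.assoc mult_2)

lemma sign_cancel:
  fixes g h c s :: int
  assumes "g * g = 1" "h * h = 1"
  shows "g * h * (h * g * c) * s = c * s"
proof -
  have "g * h * (h * g * c) * s = (g * g) * (h * h) * (c * s)" by (simp only: ac_simps)
  then show ?thesis by (simp add: assms)
qed

lemma reversal_sign_cong:
  assumes "winding Q G" "graph_iso Q G H"
  shows "reversal_sign Q Q' G = reversal_sign Q Q' H"
proof -
  obtain \<phi> where \<phi>: "inj_on (pmap \<phi>) (fst G)" "snd H = amap Q \<phi> ` snd G"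
    using assms(2) unfolding graph_iso_def iso_by_def bij_betw_def by blast
  have "reversed Q Q' (snd H) = amap Q \<phi> ` reversed Q Q' (snd G)"
    unfolding reversed_def \<phi>(2) Collect_image by simp
  moreover have "inj_on (amap Q \<phi>) (reversed Q Q' (snd G))"
    by (rule inj_on_subset[OF inj_on_amap[OF assms(1) \<phi>(1)]]) (auto simp: reversed_def)
  ultimately show ?thesis by (simp add: reversal_sign_def card_image)
qed

lemma outgoing_incoming_singleton:
  assumes "links Q G S = {e}"
  shows "outgoing Q G S = (if src Q e \<in> S then {e} else {})"
    "incoming Q G S = (if src Q e \<in> S then {} else {e})"
proof -
  have sub: "outgoing Q G S \<subseteq> {e}" "incoming Q G S \<subseteq> {e}" and e: "e \<in> links Q G S"
    using assms by blast+
  show "outgoing Q G S = (if src Q e \<in> S then {e} else {})"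
    using sub(1) e by (auto simp: outgoing_def incoming_def)
  show "incoming Q G S = (if src Q e \<in> S then {} else {e})"
    using sub(2) e by (auto simp: outgoing_def incoming_def)
qed

locale reorientation =
  fixes Q Q' :: "('v, 'a) pre_digraph"
  assumes fin_digraph: "fin_digraph Q" and fin_digraph': "fin_digraph Q'"
    and same_graph: "same_underlying_graph Q Q'"
begin

lemma swapped: "reorientation Q' Q"
  using fin_digraph fin_digraph' same_graph
  unfolding reorientation_def same_underlying_graph_def by auto

lemma verts_eq: "verts Q' = verts Q" and arcs_eq: "arcs Q' = arcs Q"
  using same_graph by (simp_all add: same_underlying_graph_def)

lemma finite_arcs: "finite (arcs Q)"
  using fin_digraph fin_digraph.finite_arcs by blast

lemma ends:
  assumes "a \<in> arcs Q"
  shows "tail Q' a = tail Q a \<Longrightarrow> head Q' a = head Q a"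
    "tail Q' a \<noteq> tail Q a \<Longrightarrow> tail Q' a = head Q a \<and> head Q' a = tail Q a"
proof -
  have "{tail Q a, head Q a} = {tail Q' a, head Q' a}"
    using assms same_graph by (simp add: same_underlying_graph_def)
  then show "tail Q' a = tail Q a \<Longrightarrow> head Q' a = head Q a"
    "tail Q' a \<noteq> tail Q a \<Longrightarrow> tail Q' a = head Q a \<and> head Q' a = tail Q a"
    by (auto simp: doubleton_eq_iff)
qed

lemma src_reverse_arrow:
  assumes "fst e \<in> arcs Q"
  shows "src Q' (reverse_arrow Q Q' e) = (if tail Q' (fst e) = tail Q (fst e) then src Q e else tgt Q e)"
    and "tgt Q' (reverse_arrow Q Q' e) = (if tail Q' (fst e) = tail Q (fst e) then tgt Q e else src Q e)"
  using assms ends[of "fst e"] by (cases e; auto simp: reverse_arrow_def)+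

lemma winding_reorient:
  assumes "winding Q G"
  shows "winding Q' (reorient Q Q' G)"
  unfolding reorient_def
proof (rule windingI)
  note w = windingD[OF assms]
  show "finite (fst G)" by (rule w(1))
  show "\<And>v x. (v, x) \<in> fst G \<Longrightarrow> v \<in> verts Q'" using w(2) verts_eq by blast
  have mem: "(a, x, y) \<in> reverse_arrow Q Q' ` snd G \<longleftrightarrow>
      (if tail Q' a = tail Q a then (a, x, y) else (a, y, x)) \<in> snd G" for a x y
  proof -
    have "(a, x, y) \<in> reverse_arrow Q Q' ` snd G \<longleftrightarrow> reverse_arrow Q' Q (a, x, y) \<in> snd G"
    proof
      assume "reverse_arrow Q' Q (a, x, y) \<in> snd G"
      then have "reverse_arrow Q Q' (reverse_arrow Q' Q (a, x, y)) \<in> reverse_arrow Q Q' ` snd G"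
        by (rule imageI)
      then show "(a, x, y) \<in> reverse_arrow Q Q' ` snd G" by simp
    qed auto
    then show ?thesis by (simp add: reverse_arrow_def eq_commute[of "tail Q a"])
  qed
  show "a \<in> arcs Q' \<and> (tail Q' a, x) \<in> fst G \<and> (head Q' a, y) \<in> fst G"
    if "(a, x, y) \<in> reverse_arrow Q Q' ` snd G" for a x y
    using that w(3-5) ends[of a] unfolding mem arcs_eq by (cases "tail Q' a = tail Q a") auto
  show "y = y'" if "(a, x, y) \<in> reverse_arrow Q Q' ` snd G" "(a, x, y') \<in> reverse_arrow Q Q' ` snd G"
    for a x y y'
    using that w(6,7) unfolding mem by (auto split: if_splits)
  show "x = x'" if "(a, x, y) \<in> reverse_arrow Q Q' ` snd G" "(a, x', y) \<in> reverse_arrow Q Q' ` snd G"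
    for a x x' y
    using that w(6,7) unfolding mem by (auto split: if_splits)
qed

lemma sub_quiver_reorient:
  assumes "winding Q G"
  shows "sub_quiver Q' (reorient Q Q' G) S = reorient Q Q' (sub_quiver Q G S)"
proof -
  have "snd (sub_quiver Q' (reorient Q Q' G) S) = snd (reorient Q Q' (sub_quiver Q G S))"
    unfolding sub_quiver_def snd_conv snd_reorient Collect_image
    using winding_src_tgt(3)[OF assms]
    by (intro image_cong Collect_cong) (auto simp: src_reverse_arrow split: if_splits)
  then show ?thesis by (simp add: prod_eq_iff)
qed

lemma links_reorient:
  assumes "winding Q G"
  shows "links Q' (reorient Q Q' G) S = reverse_arrow Q Q' ` links Q G S"
proof -
  have *: "links Q G S = {e \<in> snd G. (src Q e \<in> S) \<noteq> (tgt Q e \<in> S)}"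
    for Q :: "('v, 'a) pre_digraph" and G :: "('v, 'a, 'x) arrow_graph" and S
    unfolding outgoing_def incoming_def by blast
  show ?thesis
    unfolding * snd_reorient Collect_image
    using winding_src_tgt(3)[OF assms]
    by (intro image_cong Collect_cong) (auto simp: src_reverse_arrow split: if_splits)
qed

lemma connected_reorient:
  assumes "winding Q G"
  shows "connected_quiver Q' (reorient Q Q' G) \<longleftrightarrow> connected_quiver Q G"
  unfolding connected_quiver_def fst_reorient links_reorient[OF assms] by simp

lemma iso_by_reorient:
  assumes "winding Q G" "iso_by Q \<phi> G H"
  shows "iso_by Q' \<phi> (reorient Q Q' G) (reorient Q Q' H)"
proof -
  have "reverse_arrow Q Q' (amap Q \<phi> e) = amap Q' \<phi> (reverse_arrow Q Q' e)" if e: "e \<in> snd G" for e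
  proof -
    have "fst e \<in> arcs Q" by (rule winding_src_tgt(3)[OF assms(1) e])
    then show ?thesis
      by (intro arrow_eqI[where Q = Q']) (auto simp: src_reverse_arrow)
  qed
  then have "reverse_arrow Q Q' ` amap Q \<phi> ` snd G = amap Q' \<phi> ` reverse_arrow Q Q' ` snd G"
    unfolding image_image by (rule image_cong[OF refl])
  then show ?thesis using assms(2) unfolding iso_by_def snd_reorient fst_reorient by auto
qed

lemma graph_iso_reorient:
  assumes "winding Q G" "graph_iso Q G H"
  shows "graph_iso Q' (reorient Q Q' G) (reorient Q Q' H)"
  using assms iso_by_reorient unfolding graph_iso_def by blast

lemma graph_iso_reorient_iff:
  assumes "winding Q G"
  shows "graph_iso Q' (reorient Q Q' G) (reorient Q Q' H) \<longleftrightarrow> graph_iso Q G H"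
proof
  assume "graph_iso Q' (reorient Q Q' G) (reorient Q Q' H)"
  from reorientation.graph_iso_reorient[OF swapped winding_reorient[OF assms] this]
  show "graph_iso Q G H" by simp
qed (rule graph_iso_reorient[OF assms])

lemma splits_reorient:
  assumes "winding Q K"
  shows "splits Q' (reorient Q Q' G) (reorient Q Q' H) (reorient Q Q' K) = splits Q G H K"
  unfolding splits_def fst_reorient sub_quiver_reorient[OF assms]
  by (intro Collect_cong conj_cong refl graph_iso_reorient_iff winding_sub_quiver[OF assms]) auto

lemma reversal_sign_split:
  assumes w: "winding Q G" and S: "S \<subseteq> fst G"
  shows "reversal_sign Q Q' G = reversal_sign Q Q' (sub_quiver Q G S) *
    reversal_sign Q Q' (sub_quiver Q G (fst G - S)) * (-1) ^ card (reversed Q Q' (links Q G S))"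
proof -
  let ?A = "snd (sub_quiver Q G S)" and ?B = "snd (sub_quiver Q G (fst G - S))" and ?L = "links Q G S"
  have fin: "finite (reversed Q Q' ?A)" "finite (reversed Q Q' ?B)" "finite (reversed Q Q' ?L)"
    using finite_arrows_sub_quiver[OF w finite_arcs] by (auto simp: reversed_def)
  have "reversed Q Q' ?A \<inter> reversed Q Q' ?B = {}"
    "(reversed Q Q' ?A \<union> reversed Q Q' ?B) \<inter> reversed Q Q' ?L = {}"
    using arrows_partition(2,3)[OF assms] unfolding reversed_def by blast+
  moreover have "reversed Q Q' (snd G) = reversed Q Q' ?A \<union> reversed Q Q' ?B \<union> reversed Q Q' ?L"
    using arrows_partition(1)[OF assms] unfolding reversed_def by blast
  ultimately have "card (reversed Q Q' (snd G)) =
      card (reversed Q Q' ?A) + card (reversed Q Q' ?B) + card (reversed Q Q' ?L)"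
    using fin by (simp only: card_Un_disjoint finite_Un)
  then show ?thesis by (simp add: reversal_sign_def power_add)
qed

text \<open>
  With a single linking arrow, the sign tells its direction; reversing it exchanges incoming and
  outgoing.
\<close>

lemma split_sign_reorient:
  assumes w: "winding Q G" and S: "card (links Q G S) = 1"
  shows "split_sign Q' (reorient Q Q' G) S = (-1) ^ card (reversed Q Q' (links Q G S)) * split_sign Q G S"
proof -
  obtain e where e: "links Q G S = {e}" using S by (auto simp: card_1_singleton_iff)
  then have "e \<in> links Q G S" by blast
  then have a: "e \<in> snd G" "fst e \<in> arcs Q" and st: "(src Q e \<in> S) \<noteq> (tgt Q e \<in> S)"
    using winding_src_tgt(3)[OF w, of e] by (auto simp: outgoing_def incoming_def)
  let ?e' = "reverse_arrow Q Q' e"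
  have "links Q' (reorient Q Q' G) S = {?e'}" unfolding links_reorient[OF w] e by simp
  note out = outgoing_incoming_singleton[OF e] outgoing_incoming_singleton[OF this]
  have "reversed Q Q' {e} = (if tail Q' (fst e) = tail Q (fst e) then {} else {e})"
    by (auto simp: reversed_def)
  then show ?thesis
    unfolding split_sign_def out e
    using st src_reverse_arrow[OF a(2)] by auto
qed

text \<open>
  The Euler characteristics leave room for exactly one linking arrow in each splitting. All
  arrows of \<open>K\<close> other than this one lie in \<open>G\<close> or in \<open>H\<close>, so the product of the three reversal
  signs is \<open>-1\<close> precisely if the linking arrow is reversed.
\<close>

lemma bracket_number_reorient:
  assumes w: "winding Q G" "winding Q H" "winding Q K"
    and chi: "euler_char G = 1" "euler_char H = 1" "euler_char K = 1"
  shows "bracket_number Q' (reorient Q Q' G) (reorient Q Q' H) (reorient Q Q' K) =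
    reversal_sign Q Q' G * reversal_sign Q Q' H * reversal_sign Q Q' K * bracket_number Q G H K"
  unfolding bracket_number_def splits_reorient[OF w(3)] sum_distrib_left
proof (rule sum.cong)
  fix S assume s: "S \<in> splits Q G H K"
  then have S: "S \<subseteq> fst K" and i: "graph_iso Q (sub_quiver Q K S) H" "graph_iso Q (sub_quiver Q K (fst K - S)) G"
    by (auto simp: splits_def)
  have ws: "winding Q (sub_quiver Q K S)" "winding Q (sub_quiver Q K (fst K - S))"
    using winding_sub_quiver[OF w(3)] S by auto
  have "card (links Q K S) = 1"
    using euler_char_split[OF w(3) finite_arcs S] splits_connected(3,4)[OF w(3) s] chi by simp
  then have "split_sign Q' (reorient Q Q' K) S =
      (-1) ^ card (reversed Q Q' (links Q K S)) * split_sign Q K S"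
    by (rule split_sign_reorient[OF w(3)])
  moreover have "reversal_sign Q Q' K = reversal_sign Q Q' H * reversal_sign Q Q' G *
      (-1) ^ card (reversed Q Q' (links Q K S))"
    using reversal_sign_split[OF w(3) S] reversal_sign_cong[OF ws(1) i(1)]
      reversal_sign_cong[OF ws(2) i(2)] by simp
  ultimately show "split_sign Q' (reorient Q Q' K) S =
      reversal_sign Q Q' G * reversal_sign Q Q' H * reversal_sign Q Q' K * split_sign Q K S"
    by (simp only: sign_cancel[OF reversal_sign_square reversal_sign_square])
qed simp

end

section \<open>Forests\<close>

lemma double_quiver_simps [simp]:
  "verts (double_quiver Q) = verts Q" "arcs (double_quiver Q) = arcs Q \<times> UNIV"
  "tail (double_quiver Q) (a, b) = (if b then tail Q a else head Q a)"
  "head (double_quiver Q) (a, b) = (if b then head Q a else tail Q a)"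
  by (simp_all add: double_quiver_def)

lemma fin_digraph_double_quiver:
  assumes "fin_digraph Q"
  shows "fin_digraph (double_quiver Q)"
proof -
  interpret fin_digraph Q by fact
  show ?thesis by unfold_locales auto
qed

text \<open>
  A walk in the double quiver cannot use an arrow, in either direction, without visiting both of its
  ends. This keeps the cycles constructed below free from going back along an arrow.
\<close>

lemma apath_double_quiver_fresh:
  assumes Q: "fin_digraph Q" and p: "pre_digraph.awalk (double_quiver Q) u p v"
    and a: "z \<in> {tail Q a, head Q a}" "z \<notin> set (pre_digraph.awalk_verts (double_quiver Q) u p)"
  shows "a \<notin> fst ` set p"
proof
  interpret D: fin_digraph "double_quiver Q" by (rule fin_digraph_double_quiver[OF Q])
  assume "a \<in> fst ` set p"
  then obtain b where "(a, b) \<in> set p" by auto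
  then have "tail (double_quiver Q) (a, b) \<in> set (D.awalk_verts u p)"
    "head (double_quiver Q) (a, b) \<in> set (D.awalk_verts u p)"
    unfolding D.set_awalk_verts[OF p] by (auto intro: rev_image_eqI)
  then show False using a by (cases b) auto
qed

lemma distinct_apath_double_quiver:
  assumes Q: "fin_digraph Q" and "pre_digraph.apath (double_quiver Q) u p v"
  shows "distinct (map fst p)"
  using assms(2)
proof (induction p arbitrary: u)
  interpret D: fin_digraph "double_quiver Q" by (rule fin_digraph_double_quiver[OF Q])
  case (Cons e p)
  obtain a b where e: "e = (a, b)" by (cases e)
  have p: "D.apath (head (double_quiver Q) e) p v" "tail (double_quiver Q) e = u"
    "u \<notin> set (D.awalk_verts (head (double_quiver Q) e) p)"
    using Cons.prems by (auto simp: D.apath_Cons_iff)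
  have "u \<in> {tail Q a, head Q a}" using p(2) e by (cases b) auto
  then have "a \<notin> fst ` set p"
    using apath_double_quiver_fresh[OF Q _ _ p(3)] p(1) unfolding D.apath_def by blast
  then show ?case using Cons.IH[OF p(1)] e by simp
qed simp

text \<open>
  If every end of every arrow in \<open>A\<close> met a second arrow of \<open>A\<close>, a longest path could be prolonged
  at its start. The additional arrow would have to come from a vertex of the path, and would close
  a cycle.
\<close>

lemma forest_leaf:
  assumes Q: "fin_digraph Q" and acyclic: "\<nexists>p. undirected_cycle Q p"
    and A: "A \<subseteq> arcs Q" "A \<noteq> {}"
  shows "\<exists>a\<in>A. \<exists>v\<in>{tail Q a, head Q a}. tail Q a \<noteq> head Q a \<and>
    (\<forall>a'\<in>A. v \<in> {tail Q a', head Q a'} \<longrightarrow> a' = a)"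
proof (rule ccontr)
  assume no_leaf: "\<not> ?thesis"
  interpret fin_digraph Q by (rule Q)
  interpret D: fin_digraph "double_quiver Q" by (rule fin_digraph_double_quiver[OF Q])
  have no_loop: "tail Q a \<noteq> head Q a" if "a \<in> A" for a
  proof
    assume "tail Q a = head Q a"
    then have "undirected_cycle Q [(a, True)]"
      using that A(1) by (auto simp: undirected_cycle_def D.cycle_def D.awalk_Cons_iff D.awalk_Nil_iff)
    then show False using acyclic by blast
  qed
  have another: "\<exists>a'\<in>A. a' \<noteq> a \<and> v \<in> {tail Q a', head Q a'}" if "a \<in> A" "v \<in> {tail Q a, head Q a}" for a v
    using no_leaf that no_loop[OF that(1)] by blast
  define good where "good p \<longleftrightarrow> p \<noteq> [] \<and> fst ` set p \<subseteq> A \<and> (\<exists>u v. D.apath u p v)" for p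
  obtain a0 where a0: "a0 \<in> A" using A(2) by blast
  have "D.apath (tail Q a0) [(a0, True)] (head Q a0)"
    using a0 A(1) no_loop[OF a0] by (auto simp: D.apath_Cons_iff D.apath_Nil_iff)
  then have "good [(a0, True)]" using a0 by (auto simp: good_def)
  moreover have "\<forall>p. good p \<longrightarrow> length p \<le> card (verts Q)"
    using D.length_apath by (auto simp: good_def)
  ultimately obtain p where p: "good p" and max: "\<And>q. good q \<Longrightarrow> length q \<le> length p"
    using ex_has_greatest_nat[of good "[(a0, True)]" length "Suc (card (verts Q))"]
    by (auto simp: less_Suc_eq_le)
  then obtain e p' u v where e: "p = e # p'" "D.apath u p v" by (auto simp: good_def neq_Nil_conv)
  obtain a b where ab: "e = (a, b)" by (cases e)
  have aA: "a \<in> A" "fst ` set p' \<subseteq> A" using p e ab by (auto simp: good_def)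
  have u: "tail (double_quiver Q) e = u" "D.apath (head (double_quiver Q) e) p' v"
    "u \<notin> set (D.awalk_verts (head (double_quiver Q) e) p')"
    using e by (auto simp: D.apath_Cons_iff)
  then have "u \<in> {tail Q a, head Q a}" using ab by (cases b) auto
  then obtain a' where a': "a' \<in> A" "a' \<noteq> a" "u \<in> {tail Q a', head Q a'}" using another[OF aA(1)] by blast
  then obtain b' where b': "head (double_quiver Q) (a', b') = u"
    by (cases "head Q a' = u") (force intro: that[of True] that[of False])+
  \<comment> \<open>Prolong the path at its start by \<open>a'\<close>, coming from \<open>w\<close>.\<close>
  define w where "w = tail (double_quiver Q) (a', b')"
  have wu: "w \<noteq> u" using no_loop[OF a'(1)] b' by (cases b') (auto simp: w_def)
  have a'D: "(a', b') \<in> arcs (double_quiver Q)" using a' A(1) by auto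
  show False
  proof (cases "w \<in> set (D.awalk_verts u p)")
    case False
    then have "D.apath w ((a', b') # p) v"
      using e(2) a'D b' by (simp add: D.apath_Cons_iff w_def)
    then have "good ((a', b') # p)" using p a' by (auto simp: good_def)
    then show False using max by fastforce
  next
    case True
    have "D.awalk u p v" using e(2) by (simp add: D.apath_def)
    then obtain q r where qr: "p = q @ r" "D.awalk u q w" using D.awalk_decomp[OF _ True] by blast
    have "q \<noteq> []" using qr(2) wu by (auto simp: D.awalk_Nil_iff)
    then obtain q' where q': "q = e # q'" "p' = q' @ r" using qr(1) e(1) by (cases q) auto
    have path: "D.apath u q w"
      using e(2) qr D.apath_append_iff[of u q r v] D.awalk_ends[of u q w] by (auto simp: D.apath_def)
    have "a' \<notin> fst ` set p'"
      using apath_double_quiver_fresh[OF Q _ a'(3) u(3)] u(2) unfolding D.apath_def by blast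
    then have "distinct (map fst ((a', b') # q))"
      using distinct_apath_double_quiver[OF Q path] a'(2) q' ab by auto
    moreover have "D.cycle ((a', b') # q)"
      unfolding D.cycle_def
      using path a'D b' by (intro exI[of _ w]) (auto simp: D.awalk_Cons_iff w_def D.apath_def)
    ultimately show False using acyclic by (auto simp: undirected_cycle_def)
  qed
qed

text \<open>
  Pruning leaves proves this by induction: the weight of a leaf pays for its arrow. The nonvanishing
  of the weight survives unless the leaf carries all of it, in which case every arrow has
  weight \<open>0\<close>.
\<close>

lemma forest_weight:
  fixes k :: "'a \<Rightarrow> nat" and w :: "'v \<Rightarrow> nat"
  assumes Q: "fin_digraph (Q :: ('v, 'a) pre_digraph)" and acyclic: "\<nexists>p. undirected_cycle Q p"
    and le: "\<And>a. a \<in> arcs Q \<Longrightarrow> k a \<le> w (tail Q a) \<and> k a \<le> w (head Q a)"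
    and "finite A" "A \<subseteq> arcs Q" "finite V" "\<And>a. a \<in> A \<Longrightarrow> tail Q a \<in> V \<and> head Q a \<in> V" "sum w V \<noteq> 0"
  shows "sum k A < sum w V"
  using assms(4-)
proof (induction "card A" arbitrary: A V)
  case 0
  then have "A = {}" by simp
  then show ?case using "0.prems"(5) by (metis gr0I sum.empty)
next
  case (Suc n)
  then have "A \<noteq> {}" by auto
  from forest_leaf[OF Q acyclic Suc.prems(2) this]
  obtain a v where a: "a \<in> A" "tail Q a \<noteq> head Q a" "v \<in> {tail Q a, head Q a}"
    and leaves: "\<forall>a'\<in>A. v \<in> {tail Q a', head Q a'} \<longrightarrow> a' = a"
    by (elim bexE conjE)
  have leaf: "a' = a" if "a' \<in> A" "v \<in> {tail Q a', head Q a'}" for a'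
    using leaves that by blast
  define u where "u = (if v = tail Q a then head Q a else tail Q a)"
  have u: "u \<in> {tail Q a, head Q a}" "u \<noteq> v" using a(2,3) by (auto simp: u_def)
  let ?A = "A - {a}" and ?V = "V - {v}"
  have v: "v \<in> V" "u \<in> ?V" using a u Suc.prems(4)[OF a(1)] by auto
  have ends: "tail Q a' \<in> ?V \<and> head Q a' \<in> ?V" if "a' \<in> ?A" for a'
    using that Suc.prems(4)[of a'] leaf[of a'] by auto
  have k: "sum k A = k a + sum k ?A" and w: "sum w V = w v + sum w ?V"
    using Suc.prems(1,3) a(1) v(1) by (simp_all add: sum.remove)
  have ka: "k a \<le> w v" "k a \<le> w u" using le[of a] a u Suc.prems(2) by auto
  show ?case
  proof (cases "sum w ?V = 0")
    case False
    have "sum k ?A < sum w ?V"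
      using Suc.hyps(2) Suc.prems(1-3) a(1) ends False by (intro Suc.hyps(1)) auto
    then show ?thesis using k w ka by simp
  next
    case True
    then have 0: "w x = 0" if "x \<in> ?V" for x using that Suc.prems(3) by simp
    have "k a' = 0" if "a' \<in> ?A" for a' using that le[of a'] ends[OF that] 0 Suc.prems(2) by force
    then have "sum k ?A = 0" by simp
    moreover have "k a = 0" using ka 0 v(2) by simp
    ultimately show ?thesis using k Suc.prems(5) by simp
  qed
qed

lemma card_fibers: "finite A \<Longrightarrow> finite B \<Longrightarrow> f ` A \<subseteq> B \<Longrightarrow> card A = (\<Sum>b\<in>B. card {a \<in> A. f a = b})"
  using sum.group[of A B f "\<lambda>_. 1::nat"] by simp

text \<open>
  Apply \<open>forest_weight\<close> to the numbers of points over vertices and of arrows over arrows: the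
  latter are ranks of partial injections and so are bounded by the numbers of points at both ends.
\<close>

lemma euler_char_pos_forest:
  assumes Q: "fin_digraph Q" and acyclic: "\<nexists>p. undirected_cycle Q p"
    and w: "winding Q G" and "fst G \<noteq> {}"
  shows "euler_char G \<ge> 1"
proof -
  interpret fin_digraph Q by (rule Q)
  let ?d = "\<lambda>v. card {q \<in> fst G. fst q = v}" and ?k = "\<lambda>a. card {e \<in> snd G. fst e = a}"
  have fin: "finite (fst G)" "finite (snd G)"
    using windingD(1)[OF w] finite_winding_arrows[OF w] by auto
  have P: "card (fst G) = sum ?d (verts Q)"
    using w fin by (intro card_fibers) (auto simp: winding_def)
  have E: "card (snd G) = sum ?k (arcs Q)"
    using winding_src_tgt(3)[OF w] fin by (intro card_fibers) auto
  have "?k a \<le> ?d (tail Q a) \<and> ?k a \<le> ?d (head Q a)" for a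
  proof
    have "inj_on (src Q) {e \<in> snd G. fst e = a}" "inj_on (tgt Q) {e \<in> snd G. fst e = a}"
      using w unfolding inj_on_def winding_def by auto
    moreover have "src Q ` {e \<in> snd G. fst e = a} \<subseteq> {q \<in> fst G. fst q = tail Q a}"
      "tgt Q ` {e \<in> snd G. fst e = a} \<subseteq> {q \<in> fst G. fst q = head Q a}"
      using windingD(4,5)[OF w] by auto
    ultimately show "?k a \<le> ?d (tail Q a)" "?k a \<le> ?d (head Q a)"
      using fin by (auto intro: card_inj_on_le)
  qed
  moreover have "sum ?d (verts Q) \<noteq> 0" using P fin(1) assms(4) by (metis card_0_eq)
  ultimately have "sum ?k (arcs Q) < sum ?d (verts Q)"
    by (intro forest_weight[OF Q acyclic]) auto
  then have "card (snd G) < card (fst G)" using P E by simp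
  then show ?thesis by (simp add: euler_char_def)
qed

section \<open>Directed cycles\<close>

lemma directed_cycle_inj:
  assumes Q: "fin_digraph Q" and "directed_cycle_quiver Q"
  shows "inj_on (tail Q) (arcs Q)" "inj_on (head Q) (arcs Q)"
proof -
  interpret fin_digraph Q by (rule Q)
  obtain p where p: "cycle p" "set p = arcs Q" "tail Q ` set p = verts Q"
    using assms(2) unfolding directed_cycle_quiver_def by blast
  obtain u where u: "awalk u p u" "distinct (tl (awalk_verts u p))" "p \<noteq> []"
    using p(1) unfolding cycle_def by blast
  have tl: "tl (awalk_verts u p) = map (head Q) p" using u(1,3) awalk_verts_conv'[of u p u]
    by (simp add: awalk_def)
  then show h: "inj_on (head Q) (arcs Q)" using u(2) p(2) by (simp add: distinct_map)
  have "u = head Q (last p)" using awlast_of_awalk[OF u(1)] u(3) by (simp add: awalk_verts_conv)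
  then have "u \<in> head Q ` arcs Q" using u(3) p(2) by auto
  moreover have "set (awalk_verts u p) = insert u (head Q ` arcs Q)"
    using tl awhd_of_awalk[OF u(1)] p(2) by (cases "awalk_verts u p") auto
  moreover have "verts Q \<subseteq> set (awalk_verts u p)"
    using set_awalk_verts[OF u(1)] p(3) by auto
  ultimately have "verts Q \<subseteq> head Q ` arcs Q" by blast
  then have "card (verts Q) \<ge> card (arcs Q)"
    using card_image[OF h] card_mono[OF finite_verts, of "head Q ` arcs Q"] head_in_verts
    by (metis image_subsetI)
  moreover have "card (verts Q) \<le> card (arcs Q)"
    using \<open>verts Q \<subseteq> head Q ` arcs Q\<close> card_image[OF h] by (metis card_mono finite_arcs finite_imageI)
  ultimately have "card (tail Q ` arcs Q) = card (arcs Q)" using p by simp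
  then show "inj_on (tail Q) (arcs Q)" by (rule eq_card_imp_inj_on[OF finite_arcs])
qed

text \<open>
  Every vertex of a directed cycle is the tail of one arrow and the head of one arrow, so in a
  winding at most one arrow starts and at most one ends at each point. Counting arrows by either end
  compares their number with that of the points.
\<close>

lemma directed_cycle_euler_char:
  assumes Q: "fin_digraph Q" and cyc: "directed_cycle_quiver Q" and w: "winding Q G"
  shows "inj_on (src Q) (snd G)" "inj_on (tgt Q) (snd G)" "euler_char G \<ge> 0"
    "euler_char G = 0 \<Longrightarrow> src Q ` snd G = fst G" "euler_char G = 0 \<Longrightarrow> tgt Q ` snd G = fst G"
proof -
  interpret fin_digraph Q by (rule Q)
  have ends: "fst (src Q e) = tail Q (fst e)" "fst (tgt Q e) = head Q (fst e)" for e :: "'b \<times> 'c \<times> 'c"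
    by (cases e; simp)+
  have same: "e = e'" if "e \<in> snd G" "e' \<in> snd G" "fst e = fst e'" "src Q e = src Q e' \<or> tgt Q e = tgt Q e'" for e e'
    using that w unfolding winding_def by blast
  show s: "inj_on (src Q) (snd G)"
  proof (rule inj_onI)
    fix e e' assume e: "e \<in> snd G" "e' \<in> snd G" "src Q e = src Q e'"
    then have "fst e = fst e'"
      using directed_cycle_inj(1)[OF Q cyc] winding_src_tgt(3)[OF w] by (metis ends(1) inj_onD)
    then show "e = e'" using same e by blast
  qed
  show t: "inj_on (tgt Q) (snd G)"
  proof (rule inj_onI)
    fix e e' assume e: "e \<in> snd G" "e' \<in> snd G" "tgt Q e = tgt Q e'"
    then have "fst e = fst e'"
      using directed_cycle_inj(2)[OF Q cyc] winding_src_tgt(3)[OF w] by (metis ends(2) inj_onD)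
    then show "e = e'" using same e by blast
  qed
  have sub: "src Q ` snd G \<subseteq> fst G" "tgt Q ` snd G \<subseteq> fst G" using winding_src_tgt[OF w] by auto
  have fin: "finite (fst G)" by (rule windingD(1)[OF w])
  show "euler_char G \<ge> 0" using card_inj_on_le[OF s sub(1) fin] by (simp add: euler_char_def)
  assume 0: "euler_char G = 0"
  show "src Q ` snd G = fst G"
    using 0 card_image[OF s] by (intro card_subset_eq[OF fin sub(1)]) (simp add: euler_char_def)
  show "tgt Q ` snd G = fst G"
    using 0 card_image[OF t] by (intro card_subset_eq[OF fin sub(2)]) (simp add: euler_char_def)
qed

text \<open>
  All points of \<open>S\<close> already have their only outgoing and their only incoming arrow inside \<open>S\<close>.
\<close>

lemma directed_cycle_links:
  assumes Q: "fin_digraph Q" and cyc: "directed_cycle_quiver Q" and w: "winding Q G"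
    and S: "S \<subseteq> fst G" "euler_char (sub_quiver Q G S) = 0"
  shows "links Q G S = {}"
proof -
  note c = directed_cycle_euler_char[OF Q cyc w]
    and d = directed_cycle_euler_char(4,5)[OF Q cyc winding_sub_quiver[OF w S(1)] S(2)]
  have "tgt Q e \<in> S" if e: "e \<in> snd G" "src Q e \<in> S" for e
  proof -
    obtain e' where e': "e' \<in> snd (sub_quiver Q G S)" "src Q e' = src Q e"
      using d(1) e(2) by (metis fst_sub_quiver imageE)
    then have "e' = e" using c(1) e(1) by (auto simp: sub_quiver_def dest: inj_onD)
    then show ?thesis using e'(1) by (simp add: sub_quiver_def)
  qed
  moreover have "src Q e \<in> S" if e: "e \<in> snd G" "tgt Q e \<in> S" for e
  proof -
    obtain e' where e': "e' \<in> snd (sub_quiver Q G S)" "tgt Q e' = tgt Q e"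
      using d(2) e(2) by (metis fst_sub_quiver imageE)
    then have "e' = e" using c(2) e(1) by (auto simp: sub_quiver_def dest: inj_onD)
    then show ?thesis using e'(1) by (simp add: sub_quiver_def)
  qed
  ultimately show ?thesis unfolding outgoing_def incoming_def by blast
qed

lemma directed_cycle_nilpotent:
  assumes Q: "fin_digraph Q" and cyc: "directed_cycle_quiver Q" and w: "winding Q G"
    and con: "connected_quiver Q G" and nil: "nilpotent_quiver Q G"
  shows "euler_char G = 1"
proof (rule ccontr)
  assume "euler_char G \<noteq> 1"
  then have "euler_char G = 0"
    using directed_cycle_euler_char(3)[OF Q cyc w] euler_char_le_1[OF w fin_digraph.finite_arcs[OF Q] con]
    by simp
  then have s: "src Q ` snd G = fst G" by (rule directed_cycle_euler_char(4)[OF Q cyc w])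
  have "\<exists>e\<in>snd G. src Q e = z \<and> tgt Q e \<in> fst G" if "z \<in> fst G" for z
    using that s winding_src_tgt(2)[OF w] by (metis imageE)
  then have "fst G = {}" using nil unfolding nilpotent_quiver_def by blast
  then show False using con by (simp add: connected_quiver_def)
qed

section \<open>Primitive elements of the Hall algebra\<close>

abbreviation class_quiver ::
  "('v, 'a) pre_digraph \<Rightarrow> ('v, 'a) rep_class \<Rightarrow> ('v, 'a, nat) arrow_graph" where
  "class_quiver Q C \<equiv> coeff_quiver Q (class_rep C)"

text \<open>
  The chosen zero at a vertex may be any natural number that is not a point there; a winding has
  finitely many points, so one exists.
\<close>

definition graph_class ::
  "('v, 'a) pre_digraph \<Rightarrow> ('v, 'a, nat) arrow_graph \<Rightarrow> ('v, 'a) rep_class" where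
  "graph_class Q G = iso_class Q (rep_of Q (\<lambda>v. SOME z. (v, z) \<notin> fst G) G)"

lemma iso_class_cong:
  assumes Q: "fin_digraph Q" and r: "f1_representation Q M" "f1_representation Q N"
    and i: "graph_iso Q (coeff_quiver Q M) (coeff_quiver Q N)"
  shows "iso_class Q M = iso_class Q N"
proof -
  have i': "graph_iso Q (coeff_quiver Q N) (coeff_quiver Q M)"
    by (rule graph_iso_sym[OF winding_coeff_quiver[OF Q r(1)] i])
  have "rep_iso Q M R \<longleftrightarrow> rep_iso Q N R" if R: "f1_representation Q R" for R :: "('a, 'b, nat) f1_rep"
    unfolding rep_iso_iff_graph_iso[OF Q r(1) R] rep_iso_iff_graph_iso[OF Q r(2) R]
    using graph_iso_trans[OF i] graph_iso_trans[OF i'] by blast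
  then show ?thesis unfolding iso_class_def by blast
qed

lemma class_rep_iso_class:
  assumes Q: "fin_digraph Q" and M: "f1_representation Q (M :: ('v, 'a, nat) f1_rep)"
  shows "f1_representation Q (class_rep (iso_class Q M))"
    "graph_iso Q (coeff_quiver Q M) (class_quiver Q (iso_class Q M))"
    "class_rep (iso_class Q M) \<in> iso_class Q M"
proof -
  have "M \<in> iso_class Q M"
    unfolding iso_class_def using M rep_iso_iff_graph_iso[OF Q M M] graph_iso_refl by blast
  then show "class_rep (iso_class Q M) \<in> iso_class Q M"
    unfolding class_rep_def by (rule someI)
  then show r: "f1_representation Q (class_rep (iso_class Q M))"
    and "graph_iso Q (coeff_quiver Q M) (class_quiver Q (iso_class Q M))"
    using rep_iso_iff_graph_iso[OF Q M] by (auto simp: iso_class_def)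
qed

lemma nil_classesD:
  assumes Q: "fin_digraph Q" and C: "C \<in> nil_classes Q"
  shows "f1_representation Q (class_rep C)" "winding Q (class_quiver Q C)"
    "nilpotent_quiver Q (class_quiver Q C)" "iso_class Q (class_rep C) = C"
    "class_rep C \<in> C"
proof -
  obtain M :: "('a, 'b, nat) f1_rep" where M: "C = iso_class Q M" "f1_representation Q M" "rep_nilpotent Q M"
    using C unfolding nil_classes_def by blast
  have w: "winding Q (coeff_quiver Q M)" by (rule winding_coeff_quiver[OF Q M(2)])
  show r: "f1_representation Q (class_rep C)"
    unfolding M(1) by (rule class_rep_iso_class[OF Q M(2)])
  show "class_rep C \<in> C" unfolding M(1) by (rule class_rep_iso_class[OF Q M(2)])
  show w': "winding Q (class_quiver Q C)" using r by (rule winding_coeff_quiver[OF Q])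
  have i: "graph_iso Q (coeff_quiver Q M) (class_quiver Q C)"
    unfolding M(1) by (rule class_rep_iso_class[OF Q M(2)])
  have i': "graph_iso Q (class_quiver Q C) (coeff_quiver Q M)" by (rule graph_iso_sym[OF w i])
  show "nilpotent_quiver Q (class_quiver Q C)"
    using graph_iso_nilpotent[OF w' i'] M rep_nilpotent_iff[OF Q M(2)] by blast
  show "iso_class Q (class_rep C) = C"
    using iso_class_cong[OF Q r M(2) i'] M(1) by simp
qed

lemma nil_classes_eqI:
  assumes "fin_digraph Q" "C \<in> nil_classes Q" "D \<in> nil_classes Q"
    and "graph_iso Q (class_quiver Q C) (class_quiver Q D)"
  shows "C = D"
  using iso_class_cong[OF assms(1) nil_classesD(1)[OF assms(1,2)] nil_classesD(1)[OF assms(1,3)] assms(4)]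
    nil_classesD(4)[OF assms(1,2)] nil_classesD(4)[OF assms(1,3)] by simp

lemma graph_class:
  assumes Q: "fin_digraph Q" and G: "winding Q G"
  shows "graph_iso Q G (class_quiver Q (graph_class Q G))"
    and "nilpotent_quiver Q G \<Longrightarrow> graph_class Q G \<in> nil_classes Q"
proof -
  have "\<exists>z. (v, z) \<notin> fst G" for v
  proof -
    have "finite (snd ` fst G)" using windingD(1)[OF G] by simp
    then obtain z where "z \<notin> snd ` fst G" using ex_new_if_finite[OF infinite_UNIV_nat] by blast
    then show ?thesis by force
  qed
  then have z: "(v, SOME z. (v, z) \<notin> fst G) \<notin> fst G" for v by (rule someI_ex)
  note r = rep_of[OF Q G, of "\<lambda>v. SOME z. (v, z) \<notin> fst G", OF z]
  show "graph_iso Q G (class_quiver Q (graph_class Q G))"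
    using class_rep_iso_class(2)[OF Q r(1)] unfolding graph_class_def r(2) .
  show "nilpotent_quiver Q G \<Longrightarrow> graph_class Q G \<in> nil_classes Q"
    using rep_nilpotent_iff[OF Q r(1)] r unfolding nil_classes_def graph_class_def by auto
qed

lemma graph_class_eqI:
  assumes "fin_digraph Q" "winding Q G" "C \<in> nil_classes Q" "graph_iso Q G (class_quiver Q C)"
  shows "graph_class Q G = C"
proof (rule nil_classes_eqI[OF assms(1) _ assms(3)])
  show "graph_class Q G \<in> nil_classes Q"
    by (rule graph_class(2)[OF assms(1,2)])
      (rule graph_iso_nilpotent[OF assms(2,4) nil_classesD(3)[OF assms(1,3)]])
  show "graph_iso Q (class_quiver Q (graph_class Q G)) (class_quiver Q C)"
    by (rule graph_iso_trans[OF graph_iso_sym[OF assms(2) graph_class(1)[OF assms(1,2)]] assms(4)])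
qed

lemma graph_iso_empty:
  assumes "winding Q G" "winding Q H" "fst G = {}" "fst H = {}"
  shows "graph_iso Q G H"
proof -
  have "snd G = {}" "snd H = {}" using winding_src_tgt(1) assms by blast+
  then show ?thesis using assms unfolding graph_iso_def iso_by_def by (auto simp: bij_betw_def)
qed

lemma graph_iso_empty_iff: "graph_iso Q G H \<Longrightarrow> fst G = {} \<longleftrightarrow> fst H = {}"
  unfolding graph_iso_def iso_by_def bij_betw_def by auto

lemma hall_one_eq:
  assumes Q: "fin_digraph Q" and C: "C \<in> nil_classes Q"
  shows "hall_one Q C = of_bool (fst (class_quiver Q C) = {})"
proof -
  let ?Z = "zero_rep :: ('a, 'b, nat) f1_rep"
  have Z: "f1_representation Q ?Z" "fst (coeff_quiver Q ?Z) = {}"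
    by (auto simp: f1_representation_def f1_space_def f1_linear_def zero_rep_def coeff_quiver_def)
  have "C = iso_class Q ?Z \<longleftrightarrow> fst (class_quiver Q C) = {}"
  proof
    assume "C = iso_class Q ?Z"
    then have "graph_iso Q (coeff_quiver Q ?Z) (class_quiver Q C)"
      using class_rep_iso_class(2)[OF Q Z(1)] by simp
    then show "fst (class_quiver Q C) = {}" using Z(2) graph_iso_empty_iff by blast
  next
    assume "fst (class_quiver Q C) = {}"
    then have "graph_iso Q (class_quiver Q C) (coeff_quiver Q ?Z)"
      by (intro graph_iso_empty nil_classesD(2)[OF Q C] winding_coeff_quiver[OF Q Z(1)] Z(2))
    then show "C = iso_class Q ?Z"
      using iso_class_cong[OF Q nil_classesD(1)[OF Q C] Z(1)] nil_classesD(4)[OF Q C] by simp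
  qed
  then show ?thesis by (simp add: hall_one_def)
qed

text \<open>
  Cutting a coefficient quiver at a union \<open>S\<close> of components exhibits the representation as a direct
  sum, and the primitivity equation at the summands gives \<open>f C = 0\<close> unless one of them is zero.
  For the zero representation the equation reads \<open>f C = 2 f C\<close>.
\<close>

lemma hall_primitives_connected:
  assumes Q: "fin_digraph Q" and f: "f \<in> hall_primitives Q" "f C \<noteq> 0"
  shows "C \<in> nil_classes Q" "connected_quiver Q (class_quiver Q C)"
proof -
  let ?K = "class_quiver Q C"
  show C: "C \<in> nil_classes Q" using f by (auto simp: hall_primitives_def hall_carrier_def)
  note c = nil_classesD[OF Q C]
  have prim: "f (iso_class Q (rep_sum (class_rep A) (class_rep B))) =
      f A * hall_one Q B + hall_one Q A * f B" if "A \<in> nil_classes Q" "B \<in> nil_classes Q" for A B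
    using f(1) that by (auto simp: hall_primitives_def hall_comult_def)
  have decompose: "f C = f (graph_class Q (sub_quiver Q ?K S)) * of_bool (fst ?K - S = {}) +
      of_bool (S = {}) * f (graph_class Q (sub_quiver Q ?K (fst ?K - S)))"
    if S: "S \<subseteq> fst ?K" "links Q ?K S = {}" for S
  proof -
    let ?G = "sub_quiver Q ?K S" and ?H = "sub_quiver Q ?K (fst ?K - S)"
    define A where "A = graph_class Q ?G"
    define B where "B = graph_class Q ?H"
    have w: "winding Q ?G" "winding Q ?H" using winding_sub_quiver[OF c(2)] S by auto
    have AB: "A \<in> nil_classes Q" "B \<in> nil_classes Q"
      using graph_class(2)[OF Q w(1)] graph_class(2)[OF Q w(2)] nilpotent_sub_quiver[OF c(3)] S
      by (auto simp: A_def B_def)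
    have iA: "graph_iso Q ?G (class_quiver Q A)" and iB: "graph_iso Q ?H (class_quiver Q B)"
      using graph_class(1)[OF Q w(1)] graph_class(1)[OF Q w(2)] by (auto simp: A_def B_def)
    note a = nil_classesD[OF Q AB(1)] and b = nil_classesD[OF Q AB(2)]
    let ?R = "rep_sum (class_rep A) (class_rep B)"
    have R: "f1_representation Q ?R" by (rule f1_representation_rep_sum[OF Q a(1) b(1)])
    obtain T where T: "T \<subseteq> fst (coeff_quiver Q ?R)" "links Q (coeff_quiver Q ?R) T = {}"
      "graph_iso Q (class_quiver Q A) (sub_quiver Q (coeff_quiver Q ?R) T)"
      "graph_iso Q (class_quiver Q B)
        (sub_quiver Q (coeff_quiver Q ?R) (fst (coeff_quiver Q ?R) - T))"
      using coeff_quiver_rep_sum[OF Q a(1) b(1)] .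
    have "graph_iso Q ?K (coeff_quiver Q ?R)"
      by (rule graph_iso_glue[OF S T(1,2) c(2) winding_coeff_quiver[OF Q R]
            graph_iso_trans[OF iA T(3)] graph_iso_trans[OF iB T(4)]])
    then have "iso_class Q ?R = C" using iso_class_cong[OF Q c(1) R] c(4) by simp
    moreover have "fst (class_quiver Q A) = {} \<longleftrightarrow> S = {}" "fst (class_quiver Q B) = {} \<longleftrightarrow> fst ?K - S = {}"
      using graph_iso_empty_iff[OF iA] graph_iso_empty_iff[OF iB] by auto
    ultimately show ?thesis
      using prim[OF AB] hall_one_eq[OF Q AB(1)] hall_one_eq[OF Q AB(2)] by (simp add: A_def B_def)
  qed
  have no_links: "links Q ?K {} = {}" by (simp add: outgoing_def incoming_def)
  show "connected_quiver Q ?K"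
    unfolding connected_quiver_def
  proof (intro conjI allI impI)
    \<comment> \<open>An empty coefficient quiver splits into two copies of itself.\<close>
    show "fst ?K \<noteq> {}"
    proof
      assume e: "fst ?K = {}"
      have "graph_class Q (sub_quiver Q ?K {}) = C"
        using graph_class_eqI[OF Q c(2) C graph_iso_refl] sub_quiver_all[OF c(2)] e by simp
      then show False using decompose[of "{}"] no_links e f(2) by simp
    qed
    fix S assume S: "S \<subseteq> fst ?K" "links Q ?K S = {}"
    show "S = {} \<or> S = fst ?K"
    proof (rule ccontr)
      assume "\<not> (S = {} \<or> S = fst ?K)"
      then have "S \<noteq> {}" "fst ?K - S \<noteq> {}" using S(1) by auto
      then show False using decompose[OF S] f(2) by (simp del: Diff_eq_empty_iff)
    qed
  qed
qed

text \<open>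
  For the converse, the coefficient quiver of a direct sum is cut by its two summands without any
  linking arrows, so it is connected only if one of the summands is zero.
\<close>

lemma hall_primitives_iff:
  assumes Q: "fin_digraph Q"
  shows "f \<in> hall_primitives Q \<longleftrightarrow> finite {C. f C \<noteq> 0} \<and>
    (\<forall>C. f C \<noteq> 0 \<longrightarrow> C \<in> nil_classes Q \<and> connected_quiver Q (class_quiver Q C))"
proof
  assume f: "f \<in> hall_primitives Q"
  then have "finite {C. f C \<noteq> 0}" by (simp add: hall_primitives_def hall_carrier_def)
  then show "finite {C. f C \<noteq> 0} \<and>
    (\<forall>C. f C \<noteq> 0 \<longrightarrow> C \<in> nil_classes Q \<and> connected_quiver Q (class_quiver Q C))"
    using hall_primitives_connected[OF Q f] by simp
next
  assume f: "finite {C. f C \<noteq> 0} \<and>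
    (\<forall>C. f C \<noteq> 0 \<longrightarrow> C \<in> nil_classes Q \<and> connected_quiver Q (class_quiver Q C))"
  have "hall_comult Q f A B = f A * hall_one Q B + hall_one Q A * f B"
    if AB: "A \<in> nil_classes Q" "B \<in> nil_classes Q" for A B
  proof -
    note a = nil_classesD[OF Q AB(1)] and b = nil_classesD[OF Q AB(2)]
    let ?R = "rep_sum (class_rep A) (class_rep B)"
    let ?H = "coeff_quiver Q ?R"
    have R: "f1_representation Q ?R" by (rule f1_representation_rep_sum[OF Q a(1) b(1)])
    have wH: "winding Q ?H" by (rule winding_coeff_quiver[OF Q R])
    obtain T where T: "T \<subseteq> fst ?H" "links Q ?H T = {}"
      "graph_iso Q (class_quiver Q A) (sub_quiver Q ?H T)"
      "graph_iso Q (class_quiver Q B) (sub_quiver Q ?H (fst ?H - T))"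
      using coeff_quiver_rep_sum[OF Q a(1) b(1)] .
    have e: "fst (class_quiver Q A) = {} \<longleftrightarrow> T = {}" "fst (class_quiver Q B) = {} \<longleftrightarrow> fst ?H - T = {}"
      using graph_iso_empty_iff[OF T(3)] graph_iso_empty_iff[OF T(4)] by auto
    have f0: "f C = 0" if "fst (class_quiver Q C) = {}" for C
      using f that by (auto simp: connected_quiver_def)
    consider "T = {}" | "T = fst ?H" | "T \<noteq> {}" "T \<noteq> fst ?H" by blast
    then have "f (iso_class Q ?R) = f A * hall_one Q B + hall_one Q A * f B"
    proof cases
      case 1
      then have "iso_class Q ?R = B"
        using iso_class_cong[OF Q b(1) R] T(4) b(4) sub_quiver_all[OF wH] by simp
      then show ?thesis using 1 e f0[of A] hall_one_eq[OF Q AB(1)] by simp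
    next
      case 2
      then have "iso_class Q ?R = A"
        using iso_class_cong[OF Q a(1) R] T(3) a(4) sub_quiver_all[OF wH] by simp
      then show ?thesis using 2 e f0[of B] hall_one_eq[OF Q AB(2)] by simp
    next
      case 3
      have "f (iso_class Q ?R) = 0"
      proof (rule ccontr)
        assume n: "f (iso_class Q ?R) \<noteq> 0"
        define C where "C = iso_class Q ?R"
        have C: "C \<in> nil_classes Q" "connected_quiver Q (class_quiver Q C)" using f n by (auto simp: C_def)
        note c = nil_classesD[OF Q C(1)]
        have "rep_iso Q ?R (class_rep C)" using c(5) by (simp add: C_def iso_class_def)
        then have "graph_iso Q ?H (class_quiver Q C)" using rep_iso_iff_graph_iso[OF Q R c(1)] by blast
        then have "connected_quiver Q ?H" using graph_iso_connected[OF wH] C(2) by blast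
        then show False using 3 T(1,2) by (auto simp: connected_quiver_def)
      qed
      then show ?thesis using 3 e T(1) hall_one_eq[OF Q AB(1)] hall_one_eq[OF Q AB(2)] by auto
    qed
    then show ?thesis by (simp add: hall_comult_def)
  qed
  moreover have "f \<in> hall_carrier Q" unfolding hall_carrier_def using f by blast
  ultimately show "f \<in> hall_primitives Q" unfolding hall_primitives_def by blast
qed

lemma hall_bracket_eq:
  assumes Q: "fin_digraph Q" and f: "f \<in> hall_primitives Q" and g: "g \<in> hall_primitives Q"
    and C: "C \<in> nil_classes Q"
  shows "hall_mult Q f g C - hall_mult Q g f C =
    (\<Sum>A\<in>{A. f A \<noteq> 0}. \<Sum>B\<in>{B. g B \<noteq> 0}.
       f A * g B * of_int (bracket_number Q (class_quiver Q A) (class_quiver Q B) (class_quiver Q C)))"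
proof -
  let ?h = "\<lambda>A B. of_nat (hall_number Q (class_rep A) (class_rep B) (class_rep C)) :: complex"
  have "hall_mult Q f g C - hall_mult Q g f C =
      (\<Sum>A\<in>{A. f A \<noteq> 0}. \<Sum>B\<in>{B. g B \<noteq> 0}. f A * g B * ?h A B) -
      (\<Sum>A\<in>{A. f A \<noteq> 0}. \<Sum>B\<in>{B. g B \<noteq> 0}. g B * f A * ?h B A)"
    using C by (simp add: hall_mult_def sum.swap[of _ "{A. f A \<noteq> 0}"])
  also have "\<dots> = (\<Sum>A\<in>{A. f A \<noteq> 0}. \<Sum>B\<in>{B. g B \<noteq> 0}. f A * g B * (?h A B - ?h B A))"
    unfolding sum_subtractf[symmetric] by (simp add: algebra_simps)
  also have "\<dots> = (\<Sum>A\<in>{A. f A \<noteq> 0}. \<Sum>B\<in>{B. g B \<noteq> 0}.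
       f A * g B * of_int (bracket_number Q (class_quiver Q A) (class_quiver Q B) (class_quiver Q C)))"
  proof (intro sum.cong refl)
    fix A B assume "A \<in> {A. f A \<noteq> 0}" "B \<in> {B. g B \<noteq> 0}"
    then have "A \<in> nil_classes Q" "B \<in> nil_classes Q"
      using f g hall_primitives_connected(1)[OF Q] by auto
    then have "int (hall_number Q (class_rep A) (class_rep B) (class_rep C)) -
        int (hall_number Q (class_rep B) (class_rep A) (class_rep C)) =
        bracket_number Q (class_quiver Q A) (class_quiver Q B) (class_quiver Q C)"
      by (intro hall_number_diff[OF Q] nil_classesD(1)[OF Q] C)
    from arg_cong[OF this, of "of_int :: int \<Rightarrow> complex"] have "?h A B - ?h B A =
        of_int (bracket_number Q (class_quiver Q A) (class_quiver Q B) (class_quiver Q C))"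
      by (simp only: of_int_diff of_int_of_nat_eq)
    then show "f A * g B * (?h A B - ?h B A) =
      f A * g B * of_int (bracket_number Q (class_quiver Q A) (class_quiver Q B) (class_quiver Q C))"
      by simp
  qed
  finally show ?thesis .
qed

section \<open>Transporting primitive elements between orientations\<close>

definition tree_classes :: "('v, 'a) pre_digraph \<Rightarrow> ('v, 'a) rep_class set" where
  "tree_classes Q = {C \<in> nil_classes Q.
     connected_quiver Q (class_quiver Q C) \<and> euler_char (class_quiver Q C) = 1}"

definition reorient_class ::
  "('v, 'a) pre_digraph \<Rightarrow> ('v, 'a) pre_digraph \<Rightarrow> ('v, 'a) rep_class \<Rightarrow> ('v, 'a) rep_class" where
  "reorient_class Q Q' C = graph_class Q' (reorient Q Q' (class_quiver Q C))"

text \<open>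
  On the basis this sends the class of a tree to the class of the reoriented tree, with the
  sign given by its number of reversed arrows, and all other classes to \<open>0\<close>.
\<close>

definition reorient_fun ::
  "('v, 'a) pre_digraph \<Rightarrow> ('v, 'a) pre_digraph \<Rightarrow>
     (('v, 'a) rep_class \<Rightarrow> complex) \<Rightarrow> ('v, 'a) rep_class \<Rightarrow> complex" where
  "reorient_fun Q Q' f = (\<lambda>C. if C \<in> tree_classes Q'
     then of_int (reversal_sign Q' Q (class_quiver Q' C)) * f (reorient_class Q' Q C) else 0)"

context reorientation
begin

lemma reorient_class:
  assumes C: "C \<in> tree_classes Q"
  shows "reorient_class Q Q' C \<in> tree_classes Q'"
    and "graph_iso Q' (reorient Q Q' (class_quiver Q C)) (class_quiver Q' (reorient_class Q Q' C))"
    and "reorient_class Q' Q (reorient_class Q Q' C) = C"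
    and "reversal_sign Q' Q (class_quiver Q' (reorient_class Q Q' C)) = reversal_sign Q Q' (class_quiver Q C)"
proof -
  let ?G = "reorient Q Q' (class_quiver Q C)" and ?C' = "reorient_class Q Q' C"
  have C': "C \<in> nil_classes Q" "connected_quiver Q (class_quiver Q C)" "euler_char (class_quiver Q C) = 1"
    using C by (auto simp: tree_classes_def)
  note c = nil_classesD[OF fin_digraph C'(1)]
  have w: "winding Q' ?G" by (rule winding_reorient[OF c(2)])
  have con: "connected_quiver Q' ?G" using connected_reorient[OF c(2)] C'(2) by simp
  have nil: "nilpotent_quiver Q' ?G"
    using finite_arcs arcs_eq C'(3) by (intro nilpotent_if_euler_char_1[OF w _ con]) auto
  show i: "graph_iso Q' ?G (class_quiver Q' ?C')"
    unfolding reorient_class_def by (rule graph_class(1)[OF fin_digraph' w])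
  have n: "?C' \<in> nil_classes Q'"
    unfolding reorient_class_def by (rule graph_class(2)[OF fin_digraph' w nil])
  show "?C' \<in> tree_classes Q'"
    using n graph_iso_connected[OF w i] con graph_iso_euler_char[OF w i] C'(3)
    by (simp add: tree_classes_def)
  have w': "winding Q' (class_quiver Q' ?C')" by (rule nil_classesD(2)[OF fin_digraph' n])
  have "graph_iso Q' (class_quiver Q' ?C') ?G" by (rule graph_iso_sym[OF w i])
  from reorientation.graph_iso_reorient[OF swapped w' this]
  have "graph_iso Q (reorient Q' Q (class_quiver Q' ?C')) (class_quiver Q C)" by simp
  then show "reorient_class Q' Q ?C' = C"
    unfolding reorient_class_def[of Q' Q]
    by (rule graph_class_eqI[OF fin_digraph reorientation.winding_reorient[OF swapped w'] C'(1)])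
  show "reversal_sign Q' Q (class_quiver Q' ?C') = reversal_sign Q Q' (class_quiver Q C)"
    using reversal_sign_cong[OF w i, of Q] by simp
qed

lemma bij_reorient_class: "bij_betw (reorient_class Q Q') (tree_classes Q) (tree_classes Q')"
  using reorient_class(1,3) reorientation.reorient_class(1,3)[OF swapped]
  by (intro bij_betw_byWitness[where f' = "reorient_class Q' Q"]) auto

lemma bracket_number_reorient_class:
  assumes "A \<in> tree_classes Q" "B \<in> tree_classes Q" "C \<in> tree_classes Q"
  shows "bracket_number Q' (class_quiver Q' (reorient_class Q Q' A)) (class_quiver Q' (reorient_class Q Q' B))
      (class_quiver Q' (reorient_class Q Q' C)) =
    reversal_sign Q Q' (class_quiver Q A) * reversal_sign Q Q' (class_quiver Q B) *
    reversal_sign Q Q' (class_quiver Q C) *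
    bracket_number Q (class_quiver Q A) (class_quiver Q B) (class_quiver Q C)"
proof -
  have w: "winding Q (class_quiver Q D)" "euler_char (class_quiver Q D) = 1" if "D \<in> tree_classes Q" for D
    using that nil_classesD(2)[OF fin_digraph] by (auto simp: tree_classes_def)
  have w': "winding Q' (reorient Q Q' (class_quiver Q D))" if "D \<in> tree_classes Q" for D
    by (rule winding_reorient[OF w(1)[OF that]])
  show ?thesis
    using bracket_number_cong[OF w'[OF assms(1)] w'[OF assms(2)] w'[OF assms(3)]
        reorient_class(2)[OF assms(1)] reorient_class(2)[OF assms(2)] reorient_class(2)[OF assms(3)]]
      bracket_number_reorient[OF w(1)[OF assms(1)] w(1)[OF assms(2)] w(1)[OF assms(3)]
        w(2)[OF assms(1)] w(2)[OF assms(2)] w(2)[OF assms(3)]]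
    by simp
qed

lemma reorient_fun_primitive:
  assumes f: "f \<in> hall_primitives Q"
  shows "reorient_fun Q Q' f \<in> hall_primitives Q'"
proof -
  have "reorient_class Q' Q ` {C. reorient_fun Q Q' f C \<noteq> 0} \<subseteq> {C. f C \<noteq> 0}"
    by (auto simp: reorient_fun_def split: if_splits)
  moreover have "inj_on (reorient_class Q' Q) {C. reorient_fun Q Q' f C \<noteq> 0}"
    using reorientation.bij_reorient_class[OF swapped]
    by (auto simp: reorient_fun_def bij_betw_def intro: inj_on_subset split: if_splits)
  moreover have "finite {C. f C \<noteq> 0}" using f by (simp add: hall_primitives_iff[OF fin_digraph])
  ultimately have "finite {C. reorient_fun Q Q' f C \<noteq> 0}" using inj_on_finite by blast
  then show ?thesis
    unfolding hall_primitives_iff[OF fin_digraph']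
    by (auto simp: reorient_fun_def tree_classes_def split: if_splits)
qed

lemma reorient_fun_inverse:
  assumes "\<And>C. f C \<noteq> 0 \<Longrightarrow> C \<in> tree_classes Q'"
  shows "reorient_fun Q Q' (reorient_fun Q' Q f) = f"
proof
  interpret op: reorientation Q' Q by (rule swapped)
  fix C
  show "reorient_fun Q Q' (reorient_fun Q' Q f) C = f C"
  proof (cases "C \<in> tree_classes Q'")
    case True
    have s: "of_int (reversal_sign Q' Q (class_quiver Q' C)) * (of_int (reversal_sign Q' Q (class_quiver Q' C)) * z) = z"
      for z :: complex
      using reversal_sign_square[of Q' Q "class_quiver Q' C"]
      by (metis mult.assoc mult_1 of_int_1 of_int_mult)
    show ?thesis
      using True op.reorient_class(1,3,4)[OF True] by (simp add: reorient_fun_def s)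
  next
    case False
    then show ?thesis using assms by (auto simp: reorient_fun_def)
  qed
qed

text \<open>
  After discarding the classes that are not trees, both sides are sums over pairs of trees, matched
  by \<open>reorient_class\<close>. The signs of \<open>A\<close> and \<open>B\<close> come from transporting \<open>f\<close> and \<open>g\<close>, the sign of
  \<open>C'\<close> from transporting the bracket.
\<close>

lemma reorient_fun_bracket_on_trees:
  assumes f: "f \<in> hall_primitives Q" and g: "g \<in> hall_primitives Q"
    and C': "C' \<in> tree_classes Q'"
    and van: "\<And>A B C. \<lbrakk>A \<in> nil_classes Q; B \<in> nil_classes Q; C \<in> nil_classes Q;
        connected_quiver Q (class_quiver Q A); connected_quiver Q (class_quiver Q B);
        A \<notin> tree_classes Q \<or> B \<notin> tree_classes Q\<rbrakk>
      \<Longrightarrow> bracket_number Q (class_quiver Q A) (class_quiver Q B) (class_quiver Q C) = 0"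
  shows "reorient_fun Q Q' (\<lambda>C. hall_mult Q f g C - hall_mult Q g f C) C' =
    hall_mult Q' (reorient_fun Q Q' f) (reorient_fun Q Q' g) C' -
    hall_mult Q' (reorient_fun Q Q' g) (reorient_fun Q Q' f) C'"
proof -
  interpret op: reorientation Q' Q by (rule swapped)
  let ?F = "reorient_class Q' Q" and ?s = "\<lambda>C. of_int (reversal_sign Q' Q (class_quiver Q' C)) :: complex"
  let ?\<phi> = "reorient_fun Q Q'"
  let ?b = "\<lambda>A B C. of_int (bracket_number Q (class_quiver Q A) (class_quiver Q B) (class_quiver Q C)) :: complex"
  let ?b' = "\<lambda>A B C. of_int (bracket_number Q' (class_quiver Q' A) (class_quiver Q' B) (class_quiver Q' C)) :: complex"
  have nil: "\<And>h A. h \<in> hall_primitives Q \<Longrightarrow> h A \<noteq> 0 \<Longrightarrow> A \<in> nil_classes Q \<and> connected_quiver Q (class_quiver Q A)"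
    using hall_primitives_iff[OF fin_digraph] by blast
  have fin: "finite {A. h A \<noteq> 0}" if "h \<in> hall_primitives Q" for h
    using that by (simp add: hall_primitives_iff[OF fin_digraph])
  have FC: "?F C' \<in> tree_classes Q" "?F C' \<in> nil_classes Q" "C' \<in> nil_classes Q'"
    using op.reorient_class(1)[OF C'] C' by (auto simp: tree_classes_def)
  have reindex: "(\<Sum>A\<in>{A. h A \<noteq> 0} \<inter> tree_classes Q. k A) = (\<Sum>A\<in>{A. ?\<phi> h A \<noteq> 0}. k (?F A))"
    for h :: "('v, 'a) rep_class \<Rightarrow> complex" and k :: "('v, 'a) rep_class \<Rightarrow> complex"
  proof -
    have s0: "reversal_sign Q' Q G \<noteq> 0" for G :: "('v, 'a, nat) arrow_graph"
      by (simp add: reversal_sign_def)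
    have supp: "{A. ?\<phi> h A \<noteq> 0} = {A \<in> tree_classes Q'. h (?F A) \<noteq> 0}"
      by (auto simp: reorient_fun_def s0 split: if_splits)
    have b: "bij_betw ?F (tree_classes Q') (tree_classes Q)" by (rule op.bij_reorient_class)
    have "{A. h A \<noteq> 0} \<inter> tree_classes Q = {A \<in> ?F ` tree_classes Q'. h A \<noteq> 0}"
      using b by (auto simp: bij_betw_def)
    then have "?F ` {A \<in> tree_classes Q'. h (?F A) \<noteq> 0} = {A. h A \<noteq> 0} \<inter> tree_classes Q"
      unfolding Collect_image by simp
    moreover have "inj_on ?F {A \<in> tree_classes Q'. h (?F A) \<noteq> 0}"
      using b by (auto simp: bij_betw_def intro: inj_on_subset)
    ultimately have "bij_betw ?F {A. ?\<phi> h A \<noteq> 0} ({A. h A \<noteq> 0} \<inter> tree_classes Q)"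
      unfolding supp by (simp add: bij_betw_def)
    then show ?thesis by (rule sum.reindex_bij_betw[symmetric])
  qed
  have "?\<phi> (\<lambda>C. hall_mult Q f g C - hall_mult Q g f C) C' =
      ?s C' * (\<Sum>A\<in>{A. f A \<noteq> 0}. \<Sum>B\<in>{B. g B \<noteq> 0}. f A * g B * ?b A B (?F C'))"
    using C' hall_bracket_eq[OF fin_digraph f g FC(2)] by (simp add: reorient_fun_def)
  also have "(\<Sum>A\<in>{A. f A \<noteq> 0}. \<Sum>B\<in>{B. g B \<noteq> 0}. f A * g B * ?b A B (?F C')) =
      (\<Sum>A\<in>{A. f A \<noteq> 0} \<inter> tree_classes Q. \<Sum>B\<in>{B. g B \<noteq> 0} \<inter> tree_classes Q. f A * g B * ?b A B (?F C'))"
  proof -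
    have z: "bracket_number Q (class_quiver Q A) (class_quiver Q B) (class_quiver Q (?F C')) = 0" if "f A \<noteq> 0" "g B \<noteq> 0" "A \<notin> tree_classes Q \<or> B \<notin> tree_classes Q" for A B
      using nil[OF f that(1)] nil[OF g that(2)] van[of A B "?F C'"] FC(2) that(3) by simp
    have "(\<Sum>A\<in>{A. f A \<noteq> 0}. \<Sum>B\<in>{B. g B \<noteq> 0}. f A * g B * ?b A B (?F C')) =
        (\<Sum>A\<in>{A. f A \<noteq> 0} \<inter> tree_classes Q. \<Sum>B\<in>{B. g B \<noteq> 0}. f A * g B * ?b A B (?F C'))"
      by (intro sum.mono_neutral_right fin f ballI sum.neutral) (auto simp: z)
    also have "\<dots> = (\<Sum>A\<in>{A. f A \<noteq> 0} \<inter> tree_classes Q. \<Sum>B\<in>{B. g B \<noteq> 0} \<inter> tree_classes Q. f A * g B * ?b A B (?F C'))"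
      by (intro sum.cong sum.mono_neutral_right fin g refl ballI) (auto simp: z)
    finally show ?thesis .
  qed
  also have "\<dots> = (\<Sum>A\<in>{A. ?\<phi> f A \<noteq> 0}. \<Sum>B\<in>{B. ?\<phi> g B \<noteq> 0}. f (?F A) * g (?F B) * ?b (?F A) (?F B) (?F C'))"
    unfolding reindex ..
  also have "?s C' * \<dots> = (\<Sum>A\<in>{A. ?\<phi> f A \<noteq> 0}. \<Sum>B\<in>{B. ?\<phi> g B \<noteq> 0}. ?\<phi> f A * ?\<phi> g B * ?b' A B C')"
    unfolding sum_distrib_left
  proof (intro sum.cong refl)
    fix A B assume "A \<in> {A. ?\<phi> f A \<noteq> 0}" "B \<in> {B. ?\<phi> g B \<noteq> 0}"
    then have AB: "A \<in> tree_classes Q'" "B \<in> tree_classes Q'"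
      by (auto simp: reorient_fun_def split: if_splits)
    have "?b (?F A) (?F B) (?F C') = ?s A * ?s B * ?s C' * ?b' A B C'"
      using op.bracket_number_reorient_class[OF AB C'] by simp
    moreover have "?s C' * ?s C' = 1"
      using reversal_sign_square[of Q' Q "class_quiver Q' C'"] by (metis of_int_1 of_int_mult)
    moreover have "?s C' * (x * y * (?s A * ?s B * ?s C' * z)) = (?s C' * ?s C') * ((?s A * x) * (?s B * y) * z)"
      for x y z by (simp only: ac_simps)
    ultimately have "?s C' * (f (?F A) * g (?F B) * ?b (?F A) (?F B) (?F C')) =
        (?s A * f (?F A)) * (?s B * g (?F B)) * ?b' A B C'"
      by simp
    then show "?s C' * (f (?F A) * g (?F B) * ?b (?F A) (?F B) (?F C')) = ?\<phi> f A * ?\<phi> g B * ?b' A B C'"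
      using AB by (simp add: reorient_fun_def)
  qed
  also have "\<dots> = hall_mult Q' (?\<phi> f) (?\<phi> g) C' - hall_mult Q' (?\<phi> g) (?\<phi> f) C'"
    by (rule hall_bracket_eq[OF fin_digraph' reorient_fun_primitive[OF f] reorient_fun_primitive[OF g] FC(3), symmetric])
  finally show ?thesis .
qed

end

text \<open>
  The two properties that make transport a homomorphism onto the Lie algebra of \<open>Q'\<close> with central
  kernel: over \<open>Q'\<close> only trees occur, and over \<open>Q\<close> whatever is not a tree splits off as a
  direct summand wherever it appears.
\<close>

locale tree_comparison = reorientation +
  assumes nilpotent_tree: "\<And>G :: ('v, 'a, nat) arrow_graph. winding Q' G \<Longrightarrow> connected_quiver Q' G \<Longrightarrow>
      nilpotent_quiver Q' G \<Longrightarrow> euler_char G = 1"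
    and non_tree_no_links: "\<And>(G :: ('v, 'a, nat) arrow_graph) S. winding Q G \<Longrightarrow> S \<subseteq> fst G \<Longrightarrow>
      connected_quiver Q (sub_quiver Q G S) \<Longrightarrow> euler_char (sub_quiver Q G S) \<noteq> 1 \<Longrightarrow> links Q G S = {}"
begin

lemma bracket_number_vanish:
  assumes "A \<in> nil_classes Q" "B \<in> nil_classes Q" "C \<in> nil_classes Q"
    and con: "connected_quiver Q (class_quiver Q A)" "connected_quiver Q (class_quiver Q B)"
    and "A \<notin> tree_classes Q \<or> B \<notin> tree_classes Q"
  shows "bracket_number Q (class_quiver Q A) (class_quiver Q B) (class_quiver Q C) = 0"
proof (rule bracket_number_eq_0)
  fix S assume s: "S \<in> splits Q (class_quiver Q A) (class_quiver Q B) (class_quiver Q C)"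
  let ?K = "class_quiver Q C"
  have w: "winding Q ?K" by (rule nil_classesD(2)[OF fin_digraph assms(3)])
  have S: "S \<subseteq> fst ?K" by (rule splits_subset[OF s])
  note e = splits_connected[OF w s]
  have "euler_char (class_quiver Q A) \<noteq> 1 \<or> euler_char (class_quiver Q B) \<noteq> 1"
    using assms by (auto simp: tree_classes_def)
  then show "links Q ?K S = {}"
  proof
    assume "euler_char (class_quiver Q B) \<noteq> 1"
    then show ?thesis using non_tree_no_links[OF w S] e con by simp
  next
    assume "euler_char (class_quiver Q A) \<noteq> 1"
    then have "links Q ?K (fst ?K - S) = {}" using non_tree_no_links[OF w Diff_subset] e con by simp
    then show ?thesis using links_compl[OF w S] by auto
  qed
qed

lemma tree_classes': "C \<in> tree_classes Q' \<longleftrightarrow> C \<in> nil_classes Q' \<and> connected_quiver Q' (class_quiver Q' C)"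
  using nilpotent_tree nil_classesD(2,3)[OF fin_digraph'] unfolding tree_classes_def by blast

lemma reorient_fun_bracket:
  assumes f: "f \<in> hall_primitives Q" and g: "g \<in> hall_primitives Q"
  shows "reorient_fun Q Q' (\<lambda>C. hall_mult Q f g C - hall_mult Q g f C) C' =
    hall_mult Q' (reorient_fun Q Q' f) (reorient_fun Q Q' g) C' -
    hall_mult Q' (reorient_fun Q Q' g) (reorient_fun Q Q' f) C'"
proof (cases "C' \<in> tree_classes Q'")
  case True
  then show ?thesis using bracket_number_vanish by (intro reorient_fun_bracket_on_trees f g) auto
next
  case False
  let ?\<phi> = "reorient_fun Q Q'"
  have "hall_mult Q' (?\<phi> f) (?\<phi> g) C' - hall_mult Q' (?\<phi> g) (?\<phi> f) C' = 0"
  proof (cases "C' \<in> nil_classes Q'")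
    case nil: True
    then have "\<not> connected_quiver Q' (class_quiver Q' C')" using False tree_classes' by blast
    then have "bracket_number Q' (class_quiver Q' A) (class_quiver Q' B) (class_quiver Q' C') = 0"
      if "?\<phi> f A \<noteq> 0" "?\<phi> g B \<noteq> 0" for A B
      using that nil_classesD(2)[OF fin_digraph' nil]
      by (intro bracket_number_disconnected) (auto simp: reorient_fun_def tree_classes_def split: if_splits)
    then show ?thesis
      unfolding hall_bracket_eq[OF fin_digraph' reorient_fun_primitive[OF f] reorient_fun_primitive[OF g] nil]
      by (intro sum.neutral ballI) auto
  qed (simp add: hall_mult_def)
  then show ?thesis using False by (simp add: reorient_fun_def)
qed

lemma reorient_fun_lie_hom: "reorient_fun Q Q' \<in> lie_hom (hall_lie_algebra Q) (hall_lie_algebra Q')"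
proof -
  have "reorient_fun Q Q' (\<lambda>C. f C + g C) = (\<lambda>C. reorient_fun Q Q' f C + reorient_fun Q Q' g C)"
    and "reorient_fun Q Q' (\<lambda>C. c * f C) = (\<lambda>C. c * reorient_fun Q Q' f C)" for f g c
    by (simp_all add: reorient_fun_def fun_eq_iff algebra_simps)
  moreover have "reorient_fun Q Q' (\<lambda>C. hall_mult Q f g C - hall_mult Q g f C) =
      (\<lambda>C. hall_mult Q' (reorient_fun Q Q' f) (reorient_fun Q Q' g) C -
        hall_mult Q' (reorient_fun Q Q' g) (reorient_fun Q Q' f) C)"
    if "f \<in> hall_primitives Q" "g \<in> hall_primitives Q" for f g
    using reorient_fun_bracket[OF that] by (rule ext)
  ultimately show ?thesis
    using reorient_fun_primitive by (simp add: lie_hom_def hall_lie_algebra_def image_subset_iff)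
qed

lemma reorient_fun_onto:
  "reorient_fun Q Q' ` hall_primitives Q = hall_primitives Q'"
proof
  show "reorient_fun Q Q' ` hall_primitives Q \<subseteq> hall_primitives Q'"
    using reorient_fun_primitive by blast
  show "hall_primitives Q' \<subseteq> reorient_fun Q Q' ` hall_primitives Q"
  proof
    fix f assume f: "f \<in> hall_primitives Q'"
    then have "f C \<noteq> 0 \<Longrightarrow> C \<in> tree_classes Q'" for C
      using hall_primitives_connected[OF fin_digraph' f] tree_classes' by blast
    then have "f = reorient_fun Q Q' (reorient_fun Q' Q f)" by (rule reorient_fun_inverse[symmetric])
    then show "f \<in> reorient_fun Q Q' ` hall_primitives Q"
      using reorientation.reorient_fun_primitive[OF swapped f] by blast
  qed
qed

text \<open>
  The kernel consists of the functions vanishing on trees, and brackets with a class that is not a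
  tree vanish because such a class admits no linking arrows.
\<close>

theorem central_extension: "central_extension (hall_lie_algebra Q) (hall_lie_algebra Q')"
  unfolding central_extension_def
proof (intro bexI[of _ "reorient_fun Q Q'"] conjI reorient_fun_lie_hom)
  show "reorient_fun Q Q' ` lie_carrier (hall_lie_algebra Q) = lie_carrier (hall_lie_algebra Q')"
    using reorient_fun_onto by (simp add: hall_lie_algebra_def)
  show "{f \<in> lie_carrier (hall_lie_algebra Q). reorient_fun Q Q' f = lie_zero (hall_lie_algebra Q')}
      \<subseteq> lie_center (hall_lie_algebra Q)"
  proof
    fix f assume "f \<in> {f \<in> lie_carrier (hall_lie_algebra Q). reorient_fun Q Q' f = lie_zero (hall_lie_algebra Q')}"
    then have f: "f \<in> hall_primitives Q" and ker: "reorient_fun Q Q' f = (\<lambda>_. 0)"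
      by (simp_all add: hall_lie_algebra_def)
    have zero: "f A = 0" if A: "A \<in> tree_classes Q" for A
    proof -
      have "reorient_fun Q Q' f (reorient_class Q Q' A) = 0" using ker by simp
      then show ?thesis
        using reorient_class(1,3)[OF A] by (simp add: reorient_fun_def reversal_sign_def)
    qed
    have "hall_mult Q f g C - hall_mult Q g f C = 0" if g: "g \<in> hall_primitives Q" for g C
    proof (cases "C \<in> nil_classes Q")
      case True
      have "bracket_number Q (class_quiver Q A) (class_quiver Q B) (class_quiver Q C) = 0"
        if "f A \<noteq> 0" "g B \<noteq> 0" for A B
        using that zero hall_primitives_connected[OF fin_digraph f] hall_primitives_connected[OF fin_digraph g] True
        by (intro bracket_number_vanish) auto
      then show ?thesis
        unfolding hall_bracket_eq[OF fin_digraph f g True] by (intro sum.neutral ballI) auto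
    qed (simp add: hall_mult_def)
    then show "f \<in> lie_center (hall_lie_algebra Q)"
      using f by (simp add: lie_center_def hall_lie_algebra_def fun_eq_iff)
  qed
qed

text \<open>
  When everything over \<open>Q\<close> is a tree as well, transporting back is a left inverse.
\<close>

theorem isomorphic:
  assumes tree: "\<And>G :: ('v, 'a, nat) arrow_graph. winding Q G \<Longrightarrow> connected_quiver Q G \<Longrightarrow> euler_char G = 1"
  shows "lie_isomorphic (hall_lie_algebra Q) (hall_lie_algebra Q')"
  unfolding lie_isomorphic_def
proof (intro bexI[of _ "reorient_fun Q Q'"] reorient_fun_lie_hom)
  have inv: "reorient_fun Q' Q (reorient_fun Q Q' f) = f" if f: "f \<in> hall_primitives Q" for f
  proof -
    have "f C \<noteq> 0 \<Longrightarrow> C \<in> tree_classes Q" for C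
      using hall_primitives_connected[OF fin_digraph f] tree nil_classesD(2)[OF fin_digraph]
      unfolding tree_classes_def by blast
    then show ?thesis by (rule reorientation.reorient_fun_inverse[OF swapped])
  qed
  then have "inj_on (reorient_fun Q Q') (hall_primitives Q)"
    by (intro inj_on_inverseI[of _ "reorient_fun Q' Q"]) simp
  then show "bij_betw (reorient_fun Q Q') (lie_carrier (hall_lie_algebra Q)) (lie_carrier (hall_lie_algebra Q'))"
    using reorient_fun_onto by (simp add: bij_betw_def hall_lie_algebra_def)
qed

end

section \<open>Comparison of orientations\<close>

lemma tree_quiver_euler_char:
  assumes "fin_digraph Q" "tree_quiver Q" "winding Q G" "connected_quiver Q G"
  shows "euler_char G = 1"
  using euler_char_pos_forest[of Q G] euler_char_le_1[of Q G] assms fin_digraph.finite_arcs[of Q]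
  by (auto simp: tree_quiver_def connected_quiver_def)

text \<open>
  In the second part the Euler characteristic and the linking arrows of a winding of \<open>Q\<close> are computed
  after reorientation, over the directed cycle \<open>Q'\<close>.
\<close>

theorem theoremF:
  fixes Q Q' :: "('v, 'a) pre_digraph"
  assumes "fin_digraph Q" and "fin_digraph Q'"
    and "same_underlying_graph Q Q'"
  shows "(tree_quiver Q \<and> tree_quiver Q' \<longrightarrow>
            lie_isomorphic (hall_lie_algebra Q) (hall_lie_algebra Q')) \<and>
         (\<forall>n. equioriented_affine_A n Q' \<longrightarrow>
            central_extension (hall_lie_algebra Q) (hall_lie_algebra Q'))"
proof (intro conjI impI allI)
  interpret r: reorientation Q Q' by (rule reorientation.intro[OF assms])
  {
    assume t: "tree_quiver Q \<and> tree_quiver Q'"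
    interpret tree_comparison Q Q'
    proof unfold_locales
      show "euler_char G = 1" if "winding Q' G" "connected_quiver Q' G"
        for G :: "('v, 'a, nat) arrow_graph"
        using tree_quiver_euler_char[OF assms(2)] t that by blast
      show "links Q G S = {}"
        if "winding Q G" "S \<subseteq> fst G" "connected_quiver Q (sub_quiver Q G S)"
          "euler_char (sub_quiver Q G S) \<noteq> 1"
        for G :: "('v, 'a, nat) arrow_graph" and S
        using tree_quiver_euler_char[OF assms(1) _ winding_sub_quiver] t that by blast
    qed
    show "lie_isomorphic (hall_lie_algebra Q) (hall_lie_algebra Q')"
      using tree_quiver_euler_char[OF assms(1)] t by (intro isomorphic) blast
  }
  fix n assume "equioriented_affine_A n Q'"
  then have cyc: "directed_cycle_quiver Q'" by (simp add: equioriented_affine_A_def)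
  interpret tree_comparison Q Q'
  proof unfold_locales
    show "euler_char G = 1" if "winding Q' G" "connected_quiver Q' G" "nilpotent_quiver Q' G"
      for G :: "('v, 'a, nat) arrow_graph"
      by (rule directed_cycle_nilpotent[OF assms(2) cyc that])
    show "links Q G S = {}"
      if w: "winding Q G" and S: "S \<subseteq> fst G" and con: "connected_quiver Q (sub_quiver Q G S)"
        and chi: "euler_char (sub_quiver Q G S) \<noteq> 1"
      for G :: "('v, 'a, nat) arrow_graph" and S
    proof -
      let ?G = "reorient Q Q' G"
      have w': "winding Q' ?G" by (rule r.winding_reorient[OF w])
      have "euler_char (sub_quiver Q' ?G S) = euler_char (sub_quiver Q G S)"
        by (simp add: r.sub_quiver_reorient[OF w])
      moreover have "euler_char (sub_quiver Q G S) \<le> 1"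
        by (rule euler_char_le_1[OF winding_sub_quiver[OF w S] r.finite_arcs con])
      moreover have "euler_char (sub_quiver Q' ?G S) \<ge> 0"
        using S by (intro directed_cycle_euler_char(3)[OF assms(2) cyc] winding_sub_quiver[OF w']) simp
      ultimately have "euler_char (sub_quiver Q' ?G S) = 0" using chi by linarith
      then have "links Q' ?G S = {}"
        using S by (intro directed_cycle_links[OF assms(2) cyc w']) simp_all
      then show ?thesis unfolding r.links_reorient[OF w] by (simp only: image_is_empty)
    qed
  qed
  show "central_extension (hall_lie_algebra Q) (hall_lie_algebra Q')" by (rule central_extension)
qed

end
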